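(* Let $\lambda\in\mathbb{C}^*$, $\alpha\in\mathbb{C}$, $h\in\mathbb{C}[t]$, and let $V$ be an irreducible $\mathrm{Vir}$-module on which $d_k$ acts locally finitely for all sufficiently large $k\in\mathbb{N}$. Then the $\mathrm{Vir}$-module $\Omega(\lambda,\alpha,h)\otimes V$ is irreducible if and only if $\Omega(\lambda,\alpha,h)$ is irreducible, i.e. if and only if $\deg(h)=1$ and $\alpha\neq 0$.
   Context: $\mathrm{Vir}$ is the Lie algebra with basis $\{d_i,c\mid i\in\mathbb{Z}\}$ and brackets $[d_i,d_j]=(j-i)d_{i+j}+\delta_{i,-j}\frac{i^3-i}{12}c$, $[c,d_i]=0$. For $\lambda\in\mathbb{C}^*$, $\alpha\in\mathbb{C}$, $h\in\mathbb{C}[t]$, define operators on $\mathbb{C}[t]$ by $F(f)=\frac{h(t)-h(\alpha)}{t-\alpha}f(t)-f'(t)$ and $G(f)=h(\alpha)f+tF(f)$. The $\mathrm{Vir}$-module $\Omega(\lambda,\alpha,h)$ is the vector space $\mathbb{C}[t,s]$ with $c$ acting as $0$ and $d_m(f(t)s^i)=\lambda^m(s-m)^i\big(sf+mG(f)-m^2\alpha F(f)\big)$ for $m\in\mathbb{Z}$, $i\in\mathbb{Z}_+$, $f\in\mathbb{C}[t]$. The tensor product module has $x(a\otimes v)=xa\otimes v+a\otimes xv$ for $x\in\mathrm{Vir}$. *)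

theory Defs
  imports "HOL-Computational_Algebra.Polynomial" "HOL-Library.Function_Algebras"
begin

text \<open>A Vir-module is given by a carrier M inside an additive group, a complex scalar
multiplication sc, the action d i of the basis element d_i, and the action c of the
central element. The bracket relations of Vir are imposed as commutator identities.\<close>

definition is_vir_module ::
  "'a::ab_group_add set \<Rightarrow> (complex \<Rightarrow> 'a \<Rightarrow> 'a) \<Rightarrow> (int \<Rightarrow> 'a \<Rightarrow> 'a) \<Rightarrow> ('a \<Rightarrow> 'a) \<Rightarrow> bool" where
  "is_vir_module M sc d c \<longleftrightarrow>
     0 \<in> M \<and> (\<forall>x\<in>M. \<forall>y\<in>M. x + y \<in> M) \<and> (\<forall>a. \<forall>x\<in>M. sc a x \<in> M) \<and>
     (\<forall>a. \<forall>x\<in>M. \<forall>y\<in>M. sc a (x + y) = sc a x + sc a y) \<and>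
     (\<forall>a b. \<forall>x\<in>M. sc (a + b) x = sc a x + sc b x) \<and>
     (\<forall>a b. \<forall>x\<in>M. sc a (sc b x) = sc (a * b) x) \<and>
     (\<forall>x\<in>M. sc 1 x = x) \<and>
     (\<forall>i. \<forall>x\<in>M. d i x \<in> M) \<and> (\<forall>x\<in>M. c x \<in> M) \<and>
     (\<forall>i. \<forall>x\<in>M. \<forall>y\<in>M. d i (x + y) = d i x + d i y) \<and>
     (\<forall>i a. \<forall>x\<in>M. d i (sc a x) = sc a (d i x)) \<and>
     (\<forall>x\<in>M. \<forall>y\<in>M. c (x + y) = c x + c y) \<and>
     (\<forall>a. \<forall>x\<in>M. c (sc a x) = sc a (c x)) \<and>
     (\<forall>i j. \<forall>x\<in>M. d i (d j x) - d j (d i x) =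
          sc (of_int (j - i)) (d (i + j) x) +
          (if i = - j then sc (of_int (i ^ 3 - i) / 12) (c x) else 0)) \<and>
     (\<forall>i. \<forall>x\<in>M. c (d i x) - d i (c x) = 0)"

definition vir_submodule ::
  "'a::ab_group_add set \<Rightarrow> (complex \<Rightarrow> 'a \<Rightarrow> 'a) \<Rightarrow> (int \<Rightarrow> 'a \<Rightarrow> 'a) \<Rightarrow> ('a \<Rightarrow> 'a) \<Rightarrow> 'a set \<Rightarrow> bool" where
  "vir_submodule M sc d c W \<longleftrightarrow>
     W \<subseteq> M \<and> 0 \<in> W \<and> (\<forall>x\<in>W. \<forall>y\<in>W. x + y \<in> W) \<and> (\<forall>a. \<forall>x\<in>W. sc a x \<in> W) \<and>
     (\<forall>i. \<forall>x\<in>W. d i x \<in> W) \<and> (\<forall>x\<in>W. c x \<in> W)"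

definition vir_irreducible ::
  "'a::ab_group_add set \<Rightarrow> (complex \<Rightarrow> 'a \<Rightarrow> 'a) \<Rightarrow> (int \<Rightarrow> 'a \<Rightarrow> 'a) \<Rightarrow> ('a \<Rightarrow> 'a) \<Rightarrow> bool" where
  "vir_irreducible M sc d c \<longleftrightarrow>
     M \<noteq> {0} \<and> (\<forall>W. vir_submodule M sc d c W \<longrightarrow> W = {0} \<or> W = M)"

definition lin_span :: "(complex \<Rightarrow> 'a \<Rightarrow> 'a::ab_group_add) \<Rightarrow> 'a set \<Rightarrow> 'a set" where
  "lin_span sc B = {(\<Sum>b\<in>B. sc (f b) b) | f. True}"

definition locally_finite_op ::
  "'a::ab_group_add set \<Rightarrow> (complex \<Rightarrow> 'a \<Rightarrow> 'a) \<Rightarrow> ('a \<Rightarrow> 'a) \<Rightarrow> bool" where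
  "locally_finite_op M sc T \<longleftrightarrow>
     (\<forall>x\<in>M. \<exists>B. finite B \<and> B \<subseteq> M \<and> (\<forall>n. (T ^^ n) x \<in> lin_span sc B))"

text \<open>C[t,s] is represented as complex poly poly: the outer variable is s, the inner is t.\<close>

definition Fop :: "complex \<Rightarrow> complex poly \<Rightarrow> complex poly \<Rightarrow> complex poly" where
  "Fop \<alpha> h f = ((h - [:poly h \<alpha>:]) div [:- \<alpha>, 1:]) * f - pderiv f"

definition Gop :: "complex \<Rightarrow> complex poly \<Rightarrow> complex poly \<Rightarrow> complex poly" where
  "Gop \<alpha> h f = smult (poly h \<alpha>) f + [:0, 1:] * Fop \<alpha> h f"

definition omega_sc :: "complex \<Rightarrow> complex poly poly \<Rightarrow> complex poly poly" where
  "omega_sc a P = smult [:a:] P"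

definition omega_d :: "complex \<Rightarrow> complex \<Rightarrow> complex poly \<Rightarrow> int \<Rightarrow> complex poly poly \<Rightarrow> complex poly poly" where
  "omega_d lam \<alpha> h m P =
     (\<Sum>i\<le>degree P.
        smult [:lam powi m:]
          ([:[:- of_int m:], 1:] ^ i *
           (pCons 0 [:coeff P i:] +
            [:smult (of_int m) (Gop \<alpha> h (coeff P i)) - smult (of_int m ^ 2 * \<alpha>) (Fop \<alpha> h (coeff P i)):])))"

definition omega_c :: "complex poly poly \<Rightarrow> complex poly poly" where
  "omega_c P = 0"

text \<open>Omega has the basis t^a s^i ((a,i) \<in> nat \<times> nat), so Omega \<otimes> V is identified with the
finitely supported functions F : nat \<times> nat \<Rightarrow> V, F corresponding to sum t^a s^i \<otimes> F(a,i).\<close>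

definition tens_carrier :: "(nat \<times> nat \<Rightarrow> 'v::ab_group_add) set" where
  "tens_carrier = {F. finite {p. F p \<noteq> 0}}"

definition omega_coeff :: "complex \<Rightarrow> complex \<Rightarrow> complex poly \<Rightarrow> int \<Rightarrow> nat \<times> nat \<Rightarrow> nat \<times> nat \<Rightarrow> complex" where
  "omega_coeff lam \<alpha> h m p q =
     coeff (coeff (omega_d lam \<alpha> h m (monom (monom 1 (fst p)) (snd p))) (snd q)) (fst q)"

definition tens_sc :: "(complex \<Rightarrow> 'v \<Rightarrow> 'v) \<Rightarrow> complex \<Rightarrow> (nat \<times> nat \<Rightarrow> 'v) \<Rightarrow> (nat \<times> nat \<Rightarrow> 'v)" where
  "tens_sc sc a F = (\<lambda>q. sc a (F q))"

text \<open>d_m (t^a s^i \<otimes> v) = d_m(t^a s^i) \<otimes> v + t^a s^i \<otimes> d_m v, extended linearly.\<close>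

definition tens_d :: "complex \<Rightarrow> complex \<Rightarrow> complex poly \<Rightarrow> (complex \<Rightarrow> 'v::ab_group_add \<Rightarrow> 'v) \<Rightarrow>
    (int \<Rightarrow> 'v \<Rightarrow> 'v) \<Rightarrow> int \<Rightarrow> (nat \<times> nat \<Rightarrow> 'v) \<Rightarrow> (nat \<times> nat \<Rightarrow> 'v)" where
  "tens_d lam \<alpha> h sc d m F =
     (\<lambda>q. (\<Sum>p\<in>{p. F p \<noteq> 0}. sc (omega_coeff lam \<alpha> h m p q) (F p)) + d m (F q))"

text \<open>c acts as 0 on Omega, so c (f \<otimes> v) = f \<otimes> c v.\<close>

definition tens_c :: "('v \<Rightarrow> 'v) \<Rightarrow> (nat \<times> nat \<Rightarrow> 'v) \<Rightarrow> (nat \<times> nat \<Rightarrow> 'v)" where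
  "tens_c c F = (\<lambda>q. c (F q))"

end

theory Submission
  imports Defs
begin

text \<open>Reducibility of \<open>\<Omega>\<close>: if \<open>\<alpha> = 0\<close>, \<open>deg h = 0\<close> or \<open>deg h > 1\<close>, then the polynomials in \<open>s\<close> with
  coefficients in \<open>t\<complex>[t]\<close>, \<open>\<complex>\<close>, or the image of \<open>F\<close> (which is \<open>G\<close>-stable because \<open>G F = F (G + 1)\<close>)
  form a proper submodule, and a proper submodule of \<open>\<Omega>\<close> yields one of \<open>\<Omega> \<otimes> V\<close>.

  For the converse, every vector of \<open>V\<close> is killed by all \<open>d\<^sub>i\<close> with \<open>i\<close> large: if \<open>d\<^sub>n\<close> with \<open>n > 0\<close> is locally
  finite and \<open>X\<close> is the finite-dimensional span of a \<open>d\<^sub>n\<close>-orbit, then \<open>[d\<^sub>n, d\<^sub>i] = (i - n) d\<^sub>n\<^sub>+\<^sub>i\<close> forces the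
  \<open>d\<^sub>i X\<close>, \<open>i > n\<close>, to span a finite-dimensional space, so the annihilator \<open>K\<close> of \<open>X\<close> in the span \<open>L\<close> of these
  \<open>d\<^sub>i\<close> is a subalgebra of finite codimension. Some nonzero \<open>a \<in> K\<close> satisfies \<open>[[a, L], L] \<subseteq> K\<close>; a second
  difference of such double brackets shows that \<open>K\<close> contains all multiples of \<open>a\<close> (as a polynomial vector
  field) by high powers of the variable, and stability under \<open>[d\<^sub>n, \<cdot>]\<close> reduces \<open>a\<close> to a monomial.

  Hence for \<open>w \<in> \<Omega> \<otimes> V\<close> the vector \<open>\<lambda>\<^sup>-\<^sup>k d\<^sub>k w\<close> depends polynomially on \<open>k\<close> for large \<open>k\<close>, and a submodule
  contains its coefficients. The constant coefficient is \<open>s w\<close>, the top one is \<open>F\<close> applied to the leading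
  \<open>s\<close>-coefficient of \<open>w\<close>; for \<open>deg h = 1\<close> they lead to some \<open>1 \<otimes> v \<noteq> 0\<close> and to stability under \<open>t\<close>.\<close>

subsection \<open>Polynomial vector fields\<close>

locale vir_module =
  fixes sc :: "complex \<Rightarrow> 'v::ab_group_add \<Rightarrow> 'v" and d :: "int \<Rightarrow> 'v \<Rightarrow> 'v" and c :: "'v \<Rightarrow> 'v"
  assumes is_vir_module: "is_vir_module UNIV sc d c"
begin

sublocale vector_space sc
  using is_vir_module unfolding is_vir_module_def
  by unfold_locales auto

lemma d_add: "d i (x + y) = d i x + d i y"
  and d_scale: "d i (sc a x) = sc a (d i x)"
  and c_add: "c (x + y) = c x + c y"
  and c_scale: "c (sc a x) = sc a (c x)"
  and d_commutator: "d i (d j x) - d j (d i x) =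
          sc (of_int (j - i)) (d (i + j) x) +
          (if i = - j then sc (of_int (i ^ 3 - i) / 12) (c x) else 0)"
  using is_vir_module unfolding is_vir_module_def by blast+

lemma module_hom_d: "module_hom sc sc (d i)"
  by unfold_locales (auto simp: d_add d_scale)

lemmas d_zero = module_hom.zero[OF module_hom_d]

lemma c_zero: "c 0 = 0"
  using c_add[of 0 0] by simp

text \<open>For nonnegative indices \<open>i = - j\<close> forces both to be 0, and then both sides
  vanish; so the central term never appears.\<close>

lemma d_commutator_nonneg:
  "d (int i) (d (int j) x) - d (int j) (d (int i) x) = sc (of_nat j - of_nat i) (d (int (i + j)) x)"
proof (cases "int i = - int j")
  case True
  then have "i = 0" "j = 0" by auto
  then show ?thesis by simp
qed (simp add: d_commutator)

text \<open>The polynomial \<open>\<Sum> a\<^sub>i z\<^sup>i\<close> stands for \<open>\<Sum> a\<^sub>i d\<^sub>i\<close>; on such elements the central term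
  of the bracket vanishes.\<close>

definition witt_op :: "complex poly \<Rightarrow> 'v \<Rightarrow> 'v" where
  "witt_op a x = (\<Sum>i\<le>degree a. sc (coeff a i) (d (int i) x))"

lemma witt_op_atMost: "degree a \<le> N \<Longrightarrow> witt_op a x = (\<Sum>i\<le>N. sc (coeff a i) (d (int i) x))"
  unfolding witt_op_def by (rule sum.mono_neutral_left) (auto simp: coeff_eq_0)

lemma witt_op_add: "witt_op (a + b) x = witt_op a x + witt_op b x"
proof -
  let ?N = "max (degree a) (degree b)"
  have "degree (a + b) \<le> ?N" by (simp add: degree_add_le_max)
  then show ?thesis
    by (simp add: witt_op_atMost[of _ ?N] scale_left_distrib sum.distrib)
qed

lemma witt_op_smult: "witt_op (smult r a) x = sc r (witt_op a x)"
  by (simp add: witt_op_atMost[of _ "degree a"] scale_sum_right)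

lemma witt_op_zero [simp]: "witt_op 0 x = 0"
  by (simp add: witt_op_def)

lemma witt_op_diff: "witt_op (a - b) x = witt_op a x - witt_op b x"
  using witt_op_add[of "a - b" b x] by (simp add: algebra_simps)

lemma witt_op_monom: "witt_op (monom r i) x = sc r (d (int i) x)"
proof -
  have "witt_op (monom r i) x = (\<Sum>j\<le>i. if j = i then sc r (d (int i) x) else 0)"
    by (subst witt_op_atMost[OF degree_monom_le], rule sum.cong) auto
  then show ?thesis by simp
qed

lemma witt_op_vec_add: "witt_op a (x + y) = witt_op a x + witt_op a y"
  by (simp add: witt_op_def d_add scale_right_distrib sum.distrib)

lemma witt_op_vec_scale: "witt_op a (sc r x) = sc r (witt_op a x)"
  by (simp add: witt_op_def d_scale scale_sum_right mult.commute)

end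

lemma poly_monom_induct [case_names monom add]:
  fixes p :: "'a::comm_monoid_add poly"
  assumes "\<And>r i. P (monom r i)" and "\<And>p q. P p \<Longrightarrow> P q \<Longrightarrow> P (p + q)"
  shows "P p"
proof -
  have "P (\<Sum>i\<le>n. monom (coeff p i) i)" for n
    by (induction n) (auto intro: assms)
  then show ?thesis by (metis poly_as_sum_of_monoms)
qed

section \<open>The Witt bracket on polynomials\<close>

definition euler :: "complex poly \<Rightarrow> complex poly" where
  "euler p = [:0, 1:] * pderiv p"

lemma euler_add: "euler (p + q) = euler p + euler q"
  by (simp add: euler_def pderiv_add algebra_simps)

lemma euler_diff: "euler (p - q) = euler p - euler q"
  by (simp add: euler_def pderiv_diff algebra_simps)

lemma euler_smult: "euler (smult r p) = smult r (euler p)"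
  by (simp add: euler_def pderiv_smult)

lemma euler_mult: "euler (p * q) = euler p * q + p * euler q"
  by (simp add: euler_def pderiv_mult algebra_simps)

lemma coeff_euler: "coeff (euler p) i = of_nat i * coeff p i"
  by (cases i) (auto simp: euler_def coeff_pderiv)

lemma euler_monom: "euler (monom r i) = smult (of_nat i) (monom r i)"
  by (rule poly_eqI) (auto simp: coeff_euler)

text \<open>\<open>[d\<^sub>i, d\<^sub>j] = (j - i) d\<^sub>i\<^sub>+\<^sub>j\<close> in terms of polynomials, with \<open>euler = z \<cdot> d/dz\<close>.\<close>

definition witt_bracket :: "complex poly \<Rightarrow> complex poly \<Rightarrow> complex poly" where
  "witt_bracket a b = a * euler b - b * euler a"

lemma witt_bracket_add_left: "witt_bracket (a + b) x = witt_bracket a x + witt_bracket b x"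
  and witt_bracket_add_right: "witt_bracket x (a + b) = witt_bracket x a + witt_bracket x b"
  and witt_bracket_smult_left: "witt_bracket (smult r a) x = smult r (witt_bracket a x)"
  and witt_bracket_smult_right: "witt_bracket x (smult r a) = smult r (witt_bracket x a)"
  by (simp_all add: witt_bracket_def euler_add euler_smult algebra_simps smult_diff_right)

lemma witt_bracket_monom:
  "witt_bracket (monom r i) (monom q j) = monom ((of_nat j - of_nat i) * (r * q)) (i + j)"
  by (simp add: witt_bracket_def euler_monom smult_monom mult_monom diff_monom algebra_simps)

lemma witt_jacobi:
  "witt_bracket (witt_bracket a b) e =
     witt_bracket a (witt_bracket b e) + witt_bracket (witt_bracket a e) b"
  by (simp add: witt_bracket_def euler_diff euler_mult algebra_simps)

text \<open>For monomials a, x, y of exponents p, q, r, the double bracket of a with z^i x and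
  z^(2-i) y has coefficient (q-p+i)(r+2-p-q-2i). Its second difference in i is the constant -4, so
  all derivatives cancel and a plain product remains.\<close>

lemma witt_second_difference:
  defines "z \<equiv> monom 1 1"
  shows "witt_bracket (witt_bracket a x) (z * (z * y))
      - smult 2 (witt_bracket (witt_bracket a (z * x)) (z * y))
      + witt_bracket (witt_bracket a (z * (z * x))) y = smult (-4) (a * x * y * (z * z))"
proof -
  have z: "euler z = z" by (simp add: z_def euler_monom)
  have s: "smult 2 p = 2 * p" "smult 4 p = 4 * p" "smult (-4) p = -(4 * p)" for p :: "complex poly"
    by (simp_all add: numeral_poly)
  have "euler 2 = 0" by (simp add: euler_def numeral_poly)
  show ?thesis
    by (simp add: witt_bracket_def euler_diff euler_add euler_mult z s \<open>euler 2 = 0\<close> algebra_simps)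
qed

context vir_module
begin

text \<open>Bilinearity reduces this to monomials. Consequently the polynomials whose operators kill
  a given vector are closed under the bracket.\<close>

lemma witt_op_bracket:
  "witt_op a (witt_op b x) - witt_op b (witt_op a x) = witt_op (witt_bracket a b) x"
proof (induction a rule: poly_monom_induct)
  case (monom r i)
  show ?case
  proof (induction b rule: poly_monom_induct)
    case (monom q j)
    have "witt_op (monom r i) (witt_op (monom q j) x) - witt_op (monom q j) (witt_op (monom r i) x)
       = sc (r * q) (d (int i) (d (int j) x) - d (int j) (d (int i) x))"
      by (simp add: witt_op_monom d_scale scale_right_diff_distrib mult.commute)
    also have "\<dots> = witt_op (witt_bracket (monom r i) (monom q j)) x"
      unfolding d_commutator_nonneg
      by (simp add: witt_bracket_monom witt_op_monom mult.commute)
    finally show ?case .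
  next
    case (add p q)
    then show ?case
      by (simp add: witt_op_add witt_op_vec_add witt_bracket_add_right algebra_simps)
  qed
next
  case (add p q)
  then show ?case
    by (simp add: witt_op_add witt_op_vec_add witt_bracket_add_left algebra_simps)
qed

end

section \<open>Finite-dimensional linear algebra\<close>

text \<open>Finitely many equations in infinitely many unknowns. The freely chosen order of
  vanishing \<open>N\<close> drives the induction: it supplies two solutions with disjoint
  coefficient ranges, and a nontrivial combination of them satisfies the extra equation.\<close>

lemma homogeneous_system_nontrivial:
  fixes u :: "nat \<Rightarrow> 'e \<Rightarrow> complex"
  assumes "finite E"
  shows "\<exists>a. a \<noteq> 0 \<and> (\<forall>i<N. coeff a i = 0) \<and> (\<forall>e\<in>E. (\<Sum>i\<le>degree a. coeff a i * u i e) = 0)"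
  using assms
proof (induction E arbitrary: N rule: finite_induct)
  case empty
  show ?case by (intro exI[of _ "monom 1 N"]) auto
next
  case (insert e E)
  let ?S = "\<lambda>a e. \<Sum>i\<le>degree a. coeff a i * u i e"
  have S: "?S a e = (\<Sum>i\<le>n. coeff a i * u i e)" if "degree a \<le> n" for a e n
    using that by (intro sum.mono_neutral_left) (auto simp: coeff_eq_0)
  obtain a where a: "a \<noteq> 0" "\<forall>i<N. coeff a i = 0" "\<forall>e\<in>E. ?S a e = 0"
    using insert.IH by blast
  obtain b where b: "b \<noteq> 0" "\<forall>i<max N (Suc (degree a)). coeff b i = 0" "\<forall>e\<in>E. ?S b e = 0"
    using insert.IH by blast
  show ?case
  proof (cases "?S a e = 0")
    case True
    then show ?thesis using a by blast
  next
    case False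
    define p where "p = smult (?S b e) a - smult (?S a e) b"
    have ab: "degree a < degree b"
      using b by (metis leading_coeff_0_iff linorder_not_le max.cobounded2 le_imp_less_Suc
          less_le_trans)
    have "coeff p (degree b) = - ?S a e * lead_coeff b"
      using ab by (simp add: p_def coeff_eq_0)
    then have "p \<noteq> 0" using False b(1) by force
    moreover have deg: "degree p \<le> degree b"
      unfolding p_def by (rule degree_diff_le) (use ab in \<open>auto intro: le_trans[OF degree_smult_le]\<close>)
    have "?S p f = ?S b e * ?S a f - ?S a e * ?S b f" for f
    proof -
      have "?S p f = (\<Sum>i\<le>degree b. (?S b e * coeff a i - ?S a e * coeff b i) * u i f)"
        by (subst S[OF deg]) (simp add: p_def)
      also have "\<dots> = ?S b e * (\<Sum>i\<le>degree b. coeff a i * u i f) - ?S a e * ?S b f"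
        by (simp only: left_diff_distrib sum_subtractf mult.assoc sum_distrib_left)
      finally show ?thesis using S[OF less_imp_le[OF ab], of f] by simp
    qed
    then have "\<forall>f\<in>insert e E. ?S p f = 0" using a b by (auto simp: mult.commute)
    moreover have "\<forall>i<N. coeff p i = 0" using a b by (simp add: p_def)
    ultimately show ?thesis by blast
  qed
qed

text \<open>Restricted to \<open>E\<close>, the vectors \<open>u i\<close> lie in a
  finite-dimensional space, so finitely many of them span the rest. In the induction
  \<open>q i\<close> is the error left at the new coordinate; one index with nonzero error corrects
  all others.\<close>

lemma finite_spanning_indices:
  fixes u :: "nat \<Rightarrow> 'e \<Rightarrow> complex"
  assumes "finite E"
  shows "\<exists>M. \<forall>i. \<exists>r. \<forall>e\<in>E. u i e = (\<Sum>j<M. r j * u j e)"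
  using assms
proof (induction E rule: finite_induct)
  case empty
  show ?case by simp
next
  case (insert e E)
  then obtain M where "\<forall>i. \<exists>r. \<forall>e\<in>E. u i e = (\<Sum>j<M. r j * u j e)"
    by blast
  from choice[OF this] obtain r where r: "e \<in> E \<Longrightarrow> u i e = (\<Sum>j<M. r i j * u j e)" for i e
    by blast
  define q where "q i f = u i f - (\<Sum>j<M. r i j * u j f)" for i f
  have q0: "q i f = 0" if "f \<in> E" for i f
    unfolding q_def using r[OF that, of i] by simp
  show ?case
  proof (cases "\<forall>i. q i e = 0")
    case True
    then have "\<forall>f\<in>insert e E. q i f = 0" for i
      using q0 by blast
    then have "\<forall>f\<in>insert e E. u i f = (\<Sum>j<M. r i j * u j f)" for i
      unfolding q_def right_minus_eq .
    then show ?thesis by blast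
  next
    case False
    then obtain k where k: "q k e \<noteq> 0" by blast
    let ?N = "max M (Suc k)"
    have "\<exists>r'. \<forall>f\<in>insert e E. u i f = (\<Sum>j<?N. r' j * u j f)" for i
    proof
      \<comment> \<open>The vector \<open>q k\<close> vanishes on \<open>E\<close> but not at
        \<open>e\<close>, so adding \<open>s\<close> times it repairs the value at \<open>e\<close>
        and disturbs nothing else.\<close>
      define s where "s = q i e / q k e"
      let ?r = "\<lambda>j. (if j < M then r i j - s * r k j else 0) + (if j = k then s else 0)"
      have "(\<Sum>j<?N. ?r j * u j f) = u i f - q i f + s * q k f" for f
      proof -
        have "(\<Sum>j<?N. ?r j * u j f) = (\<Sum>j<?N. if j < M then (r i j - s * r k j) * u j f else 0)
            + (\<Sum>j<?N. if j = k then s * u k f else 0)"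
          unfolding sum.distrib[symmetric] by (intro sum.cong) (auto simp: algebra_simps)
        also have "(\<Sum>j<?N. if j < M then (r i j - s * r k j) * u j f else 0) =
            (\<Sum>j<M. (r i j - s * r k j) * u j f)"
          by (rule sum.mono_neutral_cong_right) auto
        also have "\<dots> = (\<Sum>j<M. r i j * u j f) - s * (\<Sum>j<M. r k j * u j f)"
          by (simp add: left_diff_distrib sum_subtractf sum_distrib_left mult.assoc)
        finally show ?thesis by (simp add: q_def right_diff_distrib)
      qed
      then show "\<forall>f\<in>insert e E. u i f = (\<Sum>j<?N. ?r j * u j f)"
        using q0 k by (auto simp: s_def)
    qed
    then show ?thesis by blast
  qed
qed

subsection \<open>Vanishing of high modes\<close>

context vir_module
begin

lemma witt_op_sum: "witt_op (\<Sum>i\<in>I. f i) x = (\<Sum>i\<in>I. witt_op (f i) x)"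
  by (induction I rule: infinite_finite_induct) (auto simp: witt_op_add)

lemma d_in_span:
  assumes "\<And>s. s \<in> S \<Longrightarrow> d i s \<in> span T" and "x \<in> span S"
  shows "d i x \<in> span T"
proof -
  have "subspace {x. d i x \<in> span T}"
    by (auto simp: subspace_def d_zero d_add d_scale span_zero span_add span_scale)
  with assms show ?thesis using span_induct[of x S "\<lambda>x. d i x \<in> span T"] by blast
qed

lemma witt_op_eq_0_on_span:
  assumes "\<And>s. s \<in> S \<Longrightarrow> witt_op a s = 0" and "x \<in> span S"
  shows "witt_op a x = 0"
proof -
  have "subspace {x. witt_op a x = 0}"
    using witt_op_vec_scale[of a 0 0] by (auto simp: subspace_def witt_op_vec_add witt_op_vec_scale)
  with assms show ?thesis using span_induct[of x S "\<lambda>x. witt_op a x = 0"] by blast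
qed

definition orbit_span :: "nat \<Rightarrow> 'v \<Rightarrow> 'v set" where
  "orbit_span n x = span (range (\<lambda>m. (d (int n) ^^ m) x))"

lemma orbit_span_stable: "y \<in> orbit_span n x \<Longrightarrow> d (int n) y \<in> orbit_span n x"
  unfolding orbit_span_def
proof (erule d_in_span[rotated])
  fix s assume "s \<in> range (\<lambda>m. (d (int n) ^^ m) x)"
  then obtain m where "s = (d (int n) ^^ m) x" by blast
  then have "d (int n) s = (d (int n) ^^ Suc m) x" by simp
  then show "d (int n) s \<in> span (range (\<lambda>m. (d (int n) ^^ m) x))"
    by (metis span_base rangeI)
qed

text \<open>The finite set given by local finiteness need not lie in the orbit span. A maximal
  independent subset of the orbit does, and it is finite because the span of that set contains
  it.\<close>

lemma orbit_span_finite: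
  assumes "locally_finite_op UNIV sc (d (int n))"
  obtains B where "finite B" "B \<subseteq> orbit_span n x" "orbit_span n x = span B"
proof -
  let ?O = "range (\<lambda>m. (d (int n) ^^ m) x)"
  obtain A where A: "finite A" "\<And>m. (d (int n) ^^ m) x \<in> lin_span sc A"
    using assms unfolding locally_finite_op_def by blast
  have sub: "?O \<subseteq> span A"
    using A(2) by (auto simp: lin_span_def span_finite[OF A(1)])
  obtain B where B: "B \<subseteq> ?O" "independent B" "?O \<subseteq> span B"
    using maximal_independent_subset[of ?O] by blast
  have "finite B" using independent_span_bound[OF A(1) B(2)] B(1) sub by blast
  moreover have "B \<subseteq> orbit_span n x" using B(1) span_superset unfolding orbit_span_def by blast
  moreover have "orbit_span n x = span B"
    unfolding orbit_span_def using B(1,3) span_mono span_minimal[OF B(3) subspace_span] by blast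
  ultimately show ?thesis by (rule that)
qed

text \<open>An index i > 2n is n + k with n < k < i, and k - n is nonzero, so d_i is recovered from
  the commutator of d_n and d_k. Thus the d_j with n < j and j at most 2n, followed by powers of
  d_n, produce everything, and local finiteness bounds the result.\<close>

lemma higher_modes_finite_image:
  assumes lf: "locally_finite_op UNIV sc (d (int n))" and n: "n > 0"
    and B: "finite B" "orbit_span n x = span B"
  obtains C where "finite C" "\<And>i y. n < i \<Longrightarrow> y \<in> orbit_span n x \<Longrightarrow> d (int i) y \<in> span C"
proof -
  have "\<exists>A. finite A \<and> orbit_span n y \<subseteq> span A" for y
    by (rule orbit_span_finite[OF lf, of y]) auto
  then obtain A where A: "\<And>y. finite (A y)" "\<And>y. orbit_span n y \<subseteq> span (A y)" by metis
  define S where "S = (\<Union>j\<in>{n<..2*n}. \<Union>b\<in>B. orbit_span n (d (int j) b))"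
  define C where "C = (\<Union>j\<in>{n<..2*n}. \<Union>b\<in>B. A (d (int j) b))"
  have "finite C" unfolding C_def using A(1) B(1) by auto
  have "S \<subseteq> span C"
  proof
    fix y assume "y \<in> S"
    then obtain j b where jb: "j \<in> {n<..2*n}" "b \<in> B" "y \<in> orbit_span n (d (int j) b)"
      unfolding S_def by blast
    then have "A (d (int j) b) \<subseteq> C" unfolding C_def by blast
    with A(2) jb(3) span_mono show "y \<in> span C" by blast
  qed
  then have SC: "span S \<subseteq> span C" by (rule span_minimal) (rule subspace_span)
  have stable: "d (int n) y \<in> span S" if "y \<in> span S" for y
  proof (rule d_in_span[OF _ that])
    fix s assume "s \<in> S"
    then have "d (int n) s \<in> S" unfolding S_def using orbit_span_stable by blast
    then show "d (int n) s \<in> span S" by (rule span_base)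
  qed
  have "d (int i) y \<in> span S" if "n < i" "y \<in> orbit_span n x" for i y
    using that
  proof (induction i arbitrary: y rule: less_induct)
    case (less i)
    show ?case
    proof (cases "i \<le> 2 * n")
      case True
      show ?thesis
      proof (rule d_in_span[of B])
        fix b assume "b \<in> B"
        moreover have "d (int i) b \<in> orbit_span n (d (int i) b)"
          unfolding orbit_span_def by (rule span_base) (auto intro: range_eqI[of _ _ 0])
        ultimately have "d (int i) b \<in> S" unfolding S_def using True less.prems by auto
        then show "d (int i) b \<in> span S" by (rule span_base)
      qed (use less.prems B in auto)
    next
      case False
      define k where "k = i - n"
      have k: "i = n + k" "n < k" "k < i" using False n by (auto simp: k_def)
      let ?r = "of_nat k - of_nat n :: complex"
      have "?r \<noteq> 0" using k by auto
      have "d (int n) (d (int k) y) - d (int k) (d (int n) y) = sc ?r (d (int i) y)"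
        unfolding d_commutator_nonneg k(1) ..
      then have "sc ?r (d (int i) y) \<in> span S"
        using less.IH[OF k(3,2)] orbit_span_stable[OF less.prems(2)] less.prems(2) stable
        by (metis span_diff)
      then have "sc (inverse ?r) (sc ?r (d (int i) y)) \<in> span S" by (rule span_scale)
      then show ?thesis using \<open>?r \<noteq> 0\<close> by simp
    qed
  qed
  then show ?thesis using that[OF \<open>finite C\<close>] SC by blast
qed

end

lemma witt_bracket_sum_left: "witt_bracket (\<Sum>i\<in>I. f i) x = (\<Sum>i\<in>I. witt_bracket (f i) x)"
  by (induction I rule: infinite_finite_induct)
    (auto simp: witt_bracket_add_left, simp_all add: witt_bracket_def euler_def)

text \<open>Bracketing with z^j moves the coefficient a_i to position i + j with a weight depending
  only on i and j, and the double bracket behaves likewise. Conditions on such brackets are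
  therefore linear in the coefficients of \<open>a\<close>.\<close>

lemma witt_bracket_monom_right:
  "witt_bracket a (monom 1 j) =
     (\<Sum>i\<le>degree a. monom (coeff a i * (of_nat j - of_nat i)) (i + j))"
proof -
  have "witt_bracket a (monom 1 j) = witt_bracket (\<Sum>i\<le>degree a. monom (coeff a i) i) (monom 1 j)"
    by (simp add: poly_as_sum_of_monoms)
  then show ?thesis by (simp add: witt_bracket_sum_left witt_bracket_monom mult.commute)
qed

lemma witt_bracket_monom_monom_right:
  "witt_bracket (witt_bracket a (monom 1 j)) (monom 1 k) =
     (\<Sum>i\<le>degree a. monom (coeff a i * ((of_nat j - of_nat i) * (of_nat k - of_nat (i + j)))) (i + (j + k)))"
  unfolding witt_bracket_monom_right[of a]
  by (simp add: witt_bracket_sum_left witt_bracket_monom mult_ac add_ac)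

lemma monom_dvd_euler: "monom 1 n dvd p \<Longrightarrow> monom 1 n dvd euler p"
  by (auto elim!: dvdE simp: euler_mult euler_monom intro!: dvd_add dvd_smult)

lemma monom_dvd_witt_bracket:
  "monom 1 n dvd b \<Longrightarrow> monom 1 n dvd witt_bracket a b"
  by (simp add: witt_bracket_def monom_dvd_euler dvd_diff)

text \<open>Iterating \<open>euler p - degree p \<cdot> p\<close> removes the leading terms one by one until a
  single monomial is left.\<close>

lemma euler_stable_contains_monom:
  assumes "Q p" "p \<noteq> 0"
    and "\<And>p. Q p \<Longrightarrow> Q (euler p)" and "\<And>p q. Q p \<Longrightarrow> Q q \<Longrightarrow> Q (p + q)"
    and "\<And>r p. Q p \<Longrightarrow> Q (smult r p)"
  shows "\<exists>k. Q (monom 1 k)"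
  using assms(1,2)
proof (induction "degree p" arbitrary: p rule: less_induct)
  case less
  define q where "q = euler p + smult (- of_nat (degree p)) p"
  have Q: "Q q" unfolding q_def using assms(3-5) less.prems by blast
  have c: "coeff q i = (of_nat i - of_nat (degree p)) * coeff p i" for i
    by (simp add: q_def coeff_euler algebra_simps)
  show ?case
  proof (cases "q = 0")
    case True
    then have "coeff p i = 0" if "i \<noteq> degree p" for i
      using c[of i] that by simp
    then have "p = monom (lead_coeff p) (degree p)"
      by (intro poly_eqI) auto
    then have "smult (inverse (lead_coeff p)) p = monom 1 (degree p)"
      using less.prems(2) by (metis left_inverse leading_coeff_0_iff smult_monom)
    then show ?thesis using assms(5) less.prems(1) by metis
  next
    case False
    have "degree q \<le> degree p"
      by (rule degree_le) (auto simp: c coeff_eq_0)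
    moreover have "degree q \<noteq> degree p"
      using c[of "degree p"] False by (metis diff_self leading_coeff_0_iff mult_zero_left)
    ultimately have "degree q < degree p" by linarith
    then show ?thesis using less.hyps Q False by blast
  qed
qed

context vir_module
begin

lemma high_modes_vanish_aux:
  fixes X :: "'v set"
  assumes stable: "\<And>x. x \<in> X \<Longrightarrow> d (int n) x \<in> X"
    and B: "finite B" "B \<subseteq> X" "X \<subseteq> span B"
    and C: "finite C" "\<And>i y. n < i \<Longrightarrow> y \<in> X \<Longrightarrow> d (int i) y \<in> span C"
  shows "\<exists>M. \<forall>i\<ge>M. \<forall>x\<in>X. d (int i) x = 0"
proof -
  \<comment> \<open>\<open>L\<close> is the span of the d_i with i > n, an ideal among the
    polynomial vector fields; \<open>K\<close> is the annihilator of \<open>X\<close> in it.\<close>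
  define L where "L = {a :: complex poly. monom 1 (Suc n) dvd a}"
  define K where "K = {a \<in> L. \<forall>x\<in>X. witt_op a x = 0}"
  have L_br: "witt_bracket a b \<in> L" if "b \<in> L" for a b
    using that monom_dvd_witt_bracket unfolding L_def by blast
  have K_I: "a \<in> K" if "a \<in> L" "\<And>b. b \<in> B \<Longrightarrow> witt_op a b = 0" for a
    using that B(3) witt_op_eq_0_on_span unfolding K_def by blast
  have K_add: "a + b \<in> K" if "a \<in> K" "b \<in> K" for a b
    using that by (auto simp: K_def L_def witt_op_add)
  have K_smult: "smult r a \<in> K" if "a \<in> K" for a r
    using that by (auto simp: K_def L_def witt_op_smult intro: dvd_smult)
  have K_diff: "a - b \<in> K" if "a \<in> K" "b \<in> K" for a b
    using K_add[OF that(1) K_smult[OF that(2), of "-1"]] by simp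
  have K_br: "witt_bracket a b \<in> K" if "a \<in> K" "b \<in> K" for a b
  proof -
    have "witt_op (witt_bracket a b) x = 0" if "x \<in> X" for x
      unfolding witt_op_bracket[symmetric] using \<open>a \<in> K\<close> \<open>b \<in> K\<close> that witt_op_vec_scale[of _ 0 0]
      by (simp add: K_def)
    then show ?thesis using that L_br by (auto simp: K_def)
  qed
  \<comment> \<open>The monomial z^n is not in \<open>L\<close>, but d_n preserves \<open>X\<close>,
    so bracketing with it preserves \<open>K\<close>.\<close>
  have K_br_n: "witt_bracket (monom 1 n) b \<in> K" if "b \<in> K" for b
  proof -
    have "witt_op (witt_bracket (monom 1 n) b) x = 0" if "x \<in> X" for x
      unfolding witt_op_bracket[symmetric] using \<open>b \<in> K\<close> that stable[OF that]
      by (simp add: K_def witt_op_monom d_zero)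
    then show ?thesis using that L_br by (auto simp: K_def)
  qed
  have "\<forall>i b. \<exists>r. n < i \<longrightarrow> b \<in> B \<longrightarrow> d (int i) b = (\<Sum>g\<in>C. sc (r g) g)"
    using C(2) B(2) unfolding span_finite[OF C(1)] by (auto simp: image_iff)
  then obtain co where co: "\<And>i b. n < i \<Longrightarrow> b \<in> B \<Longrightarrow> d (int i) b = (\<Sum>g\<in>C. sc (co i b g) g)"
    by metis
  \<comment> \<open>Coordinates are set to 0 for indices up to \<open>n\<close>, where
    \<open>co\<close> carries no information; so only the indices in \<open>J\<close> survive in the
    spanning relations.\<close>
  obtain M where M: "\<forall>i. \<exists>r. \<forall>e\<in>B \<times> C.
      (case e of (b, g) \<Rightarrow> if n < i then co i b g else 0) =
      (\<Sum>j<M. r j * (case e of (b, g) \<Rightarrow> if n < j then co j b g else 0))"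
    using finite_spanning_indices[of "B \<times> C" "\<lambda>i (b, g). if n < i then co i b g else 0"] B(1) C(1)
    by blast
  define J where "J = {n<..<M}"
  have "finite J" by (simp add: J_def)
  have L_monom: "monom r i \<in> L" if "n < i" for i r
    unfolding L_def using that by (simp add: monom_1_dvd_iff')
  have red: "\<exists>r. monom 1 i - (\<Sum>j\<in>J. monom (r j) j) \<in> K" if i: "n < i" for i
  proof -
    obtain r where r: "\<And>b g. b \<in> B \<Longrightarrow> g \<in> C \<Longrightarrow>
        co i b g = (\<Sum>j<M. r j * (if n < j then co j b g else 0))"
      using M i by (force dest: spec[of _ i])
    have r': "co i b g = (\<Sum>j\<in>J. r j * co j b g)" if "b \<in> B" "g \<in> C" for b g
      unfolding r[OF that] J_def by (rule sum.mono_neutral_cong_right) auto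
    have "monom 1 i - (\<Sum>j\<in>J. monom (r j) j) \<in> K"
    proof (rule K_I)
      show "monom 1 i - (\<Sum>j\<in>J. monom (r j) j) \<in> L"
        using L_monom i unfolding L_def by (auto simp: J_def intro!: dvd_diff dvd_sum)
      fix b assume b: "b \<in> B"
      have "(\<Sum>j\<in>J. sc (r j) (d (int j) b)) = (\<Sum>j\<in>J. \<Sum>g\<in>C. sc (r j * co j b g) g)"
        using b by (intro sum.cong) (auto simp: J_def co scale_sum_right)
      also have "\<dots> = (\<Sum>g\<in>C. sc (co i b g) g)"
        unfolding sum.swap[of _ C J] using b by (intro sum.cong) (auto simp: r' scale_sum_left)
      finally show "witt_op (monom 1 i - (\<Sum>j\<in>J. monom (r j) j)) b = 0"
        using b i by (simp add: witt_op_diff witt_op_sum witt_op_monom co)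
    qed
    then show ?thesis by blast
  qed
  have L_sub: "L \<subseteq> S" if S: "K \<subseteq> S" "\<And>j. j \<in> J \<Longrightarrow> monom 1 j \<in> S"
      "\<And>a b. a \<in> S \<Longrightarrow> b \<in> S \<Longrightarrow> a + b \<in> S" "\<And>r a. a \<in> S \<Longrightarrow> smult r a \<in> S" for S
  proof
    fix a assume "a \<in> L"
    then obtain u where "a = monom 1 (Suc n) * u" unfolding L_def by (auto elim: dvdE)
    moreover have "monom 1 (Suc n) * u \<in> S"
    proof (induction u rule: poly_monom_induct)
      case (monom q i)
      obtain r where r: "monom 1 (Suc n + i) - (\<Sum>j\<in>J. monom (r j) j) \<in> K"
        using red[of "Suc n + i"] by auto
      have "0 \<in> S" using S(4)[of _ 0] r S(1) by (metis smult_0_left subsetD)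
      have "(\<Sum>j\<in>I. monom (r j) j) \<in> S" if "I \<subseteq> J" for I
        using finite_subset[OF that \<open>finite J\<close>] that
      proof (induction I rule: finite_induct)
        case (insert j I)
        then show ?case using S(3) S(4)[OF S(2), of j "r j"] by (simp add: smult_monom)
      qed (simp add: \<open>0 \<in> S\<close>)
      then have "monom 1 (Suc n + i) \<in> S" using S(1,3) r by (metis diff_add_cancel subsetD order_refl)
      then have "smult q (monom 1 (Suc n + i)) \<in> S" by (rule S(4))
      then show ?case by (simp add: smult_monom mult_monom)
    next
      case (add p q)
      then show ?case using S(3) by (simp add: distrib_left)
    qed
    ultimately show "a \<in> S" by simp
  qed
  \<comment> \<open>A pair (w, s) encodes the map from \<open>a\<close> to the sum of the a_i w(i)
    z^(i+s). The three families are \<open>a\<close>, [a, z^j] and [[a, z^j], z^k] with j, k in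
    \<open>J\<close>; asking that all of them kill \<open>B\<close> gives finitely many equations on
    \<open>a\<close>.\<close>
  define P :: "((nat \<Rightarrow> complex) \<times> nat) set" where
    "P = insert (\<lambda>_. 1, 0) ((\<lambda>j. (\<lambda>i. of_nat j - of_nat i, j)) ` J \<union>
         (\<lambda>(j, k). (\<lambda>i. (of_nat j - of_nat i) * (of_nat k - of_nat (i + j)), j + k)) ` (J \<times> J))"
  have "finite P" unfolding P_def using \<open>finite J\<close> by simp
  then have "finite (P \<times> B \<times> C)" using B(1) C(1) by simp
  from homogeneous_system_nontrivial[OF this, of "Suc n"
      "\<lambda>i e. case e of ((w, s), b, g) \<Rightarrow> w i * co (i + s) b g"]
  obtain a where A: "a \<noteq> 0 \<and> (\<forall>i<Suc n. coeff a i = 0) \<and> (\<forall>e\<in>P \<times> B \<times> C.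
      (\<Sum>i\<le>degree a. coeff a i * (case e of ((w, s), b, g) \<Rightarrow> w i * co (i + s) b g)) = 0)"
    by (rule exE)
  note a = conjunct1[OF A] conjunct1[OF conjunct2[OF A]]
  note a0 = bspec[OF conjunct2[OF conjunct2[OF A]]]
  have a3: "(\<Sum>i\<le>degree a. coeff a i * (w i * co (i + s) b g)) = 0"
    if "(w, s) \<in> P" "b \<in> B" "g \<in> C" for w s b g
    using a0[of "((w, s), b, g)"] that by simp
  have kill: "(\<Sum>i\<le>degree a. monom (coeff a i * w i) (i + s)) \<in> K" if "(w, s) \<in> P" for w s
  proof (rule K_I)
    show "(\<Sum>i\<le>degree a. monom (coeff a i * w i) (i + s)) \<in> L"
      unfolding L_def
    proof (intro CollectI dvd_sum)
      fix i
      show "monom 1 (Suc n) dvd monom (coeff a i * w i) (i + s)"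
        using a(2) L_monom[of "i + s"] by (cases "n < i") (auto simp: L_def)
    qed
    fix b assume b: "b \<in> B"
    have "witt_op (\<Sum>i\<le>degree a. monom (coeff a i * w i) (i + s)) b =
        (\<Sum>i\<le>degree a. sc (coeff a i * w i) (d (int (i + s)) b))"
      by (simp only: witt_op_sum witt_op_monom)
    also have "\<dots> = (\<Sum>i\<le>degree a. \<Sum>g\<in>C. sc (coeff a i * (w i * co (i + s) b g)) g)"
    proof (rule sum.cong[OF refl])
      fix i
      show "sc (coeff a i * w i) (d (int (i + s)) b) =
          (\<Sum>g\<in>C. sc (coeff a i * (w i * co (i + s) b g)) g)"
        using a(2) b by (cases "n < i") (auto simp: co scale_sum_right mult.assoc simp del: of_nat_add)
    qed
    also have "\<dots> = 0"
      unfolding sum.swap[of _ C] using a3[OF that b] by (simp flip: scale_sum_left)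
    finally show "witt_op (\<Sum>i\<le>degree a. monom (coeff a i * w i) (i + s)) b = 0" .
  qed
  have aK: "a \<in> K"
    using kill[of "\<lambda>_. 1" 0] by (simp add: P_def poly_as_sum_of_monoms)
  have a1: "witt_bracket a (monom 1 j) \<in> K" if "j \<in> J" for j
    unfolding witt_bracket_monom_right using that by (intro kill) (auto simp: P_def)
  have a2: "witt_bracket (witt_bracket a (monom 1 j)) (monom 1 k) \<in> K" if "j \<in> J" "k \<in> J" for j k
    unfolding witt_bracket_monom_monom_right using that by (intro kill) (force simp: P_def)
  \<comment> \<open>\<open>L = K + span {z\<^sup>j | j \<in> J}\<close>, so the finitely many conditions imposed on \<open>a\<close> suffice for all of \<open>L\<close>.\<close>
  have aL1: "witt_bracket a x \<in> K" if "x \<in> L" for x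
    using L_sub[of "{x. witt_bracket a x \<in> K}"] that K_br[OF aK] a1
    by (auto simp: witt_bracket_add_right witt_bracket_smult_right K_add K_smult)
  have aL2': "witt_bracket (witt_bracket a x) (monom 1 k) \<in> K" if "x \<in> L" "k \<in> J" for x k
  proof -
    \<comment> \<open>By Jacobi this is [a, [x, z^k]] + [[a, z^k], x]. The first term is covered by
      \<open>aL1\<close>, the second is a bracket of two elements of \<open>K\<close>.\<close>
    have "witt_bracket (witt_bracket a x) (monom 1 k) \<in> K" if "x \<in> K" for x
    proof -
      have "witt_bracket x (monom 1 k) \<in> L" using \<open>k \<in> J\<close> by (intro L_br L_monom) (simp add: J_def)
      then show ?thesis unfolding witt_jacobi[of a x]
        using aL1 K_br[OF a1[OF \<open>k \<in> J\<close>] that] K_add by blast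
    qed
    then show ?thesis
      using L_sub[of "{x. witt_bracket (witt_bracket a x) (monom 1 k) \<in> K}"] that a2
      by (auto simp: witt_bracket_add_right witt_bracket_smult_right
          witt_bracket_add_left witt_bracket_smult_left K_add K_smult)
  qed
  have aL2: "witt_bracket (witt_bracket a x) y \<in> K" if "x \<in> L" "y \<in> L" for x y
    using L_sub[of "{y. witt_bracket (witt_bracket a x) y \<in> K}"] that K_br[OF aL1] aL2'
    by (auto simp: witt_bracket_add_right witt_bracket_smult_right K_add K_smult)
  \<comment> \<open>\<open>Q p\<close> says that \<open>p\<close> times some power of z generates an
    ideal of the polynomial ring contained in \<open>K\<close>.\<close>
  define Q where "Q p \<longleftrightarrow> (\<exists>S. \<forall>w. p * (monom 1 S * w) \<in> K)" for p
  have Qa: "Q a"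
    unfolding Q_def
  proof (intro exI allI)
    fix w :: "complex poly"
    \<comment> \<open>Both \<open>?x\<close> and \<open>?y\<close> stay in \<open>L\<close> after
      multiplication by z, so every double bracket in the second difference lies in
      \<open>K\<close>, and with it the product that the difference equals.\<close>
    let ?x = "monom 1 (Suc n) :: complex poly" and ?z = "monom 1 1 :: complex poly"
    let ?y = "?x * w"
    have L: "p * ?x \<in> L" "p * ?y \<in> L" "?x \<in> L" "?y \<in> L" for p
      by (simp_all add: L_def)
    have "witt_bracket (witt_bracket a ?x) (?z * (?z * ?y))
      - smult 2 (witt_bracket (witt_bracket a (?z * ?x)) (?z * ?y))
      + witt_bracket (witt_bracket a (?z * (?z * ?x))) ?y \<in> K"
      using L by (intro K_add K_diff K_smult aL2) (simp_all add: L_def)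
    then have "smult (-4) (a * ?x * ?y * (?z * ?z)) \<in> K" unfolding witt_second_difference .
    from K_smult[OF this, of "- 1 / 4"] show "a * (monom 1 (Suc n + Suc n + 2) * w) \<in> K"
      by (simp add: mult_monom mult_ac flip: mult.assoc)
  qed
  have Q_mono: "\<exists>S. \<forall>T\<ge>S. \<forall>w. p * (monom 1 T * w) \<in> K" if Qp: "Q p" for p
  proof -
    obtain S where S: "\<And>w. p * (monom 1 S * w) \<in> K" using Qp unfolding Q_def by blast
    have "p * (monom 1 T * w) \<in> K" if "S \<le> T" for T w
      using S[of "monom 1 (T - S) * w"] that by (simp add: mult_monom flip: mult.assoc)
    then show ?thesis by blast
  qed
  have Q_add: "Q (p + q)" if pq: "Q p" "Q q" for p q
  proof -
    obtain S T where "\<forall>U\<ge>S. \<forall>w. p * (monom 1 U * w) \<in> K" "\<forall>U\<ge>T. \<forall>w. q * (monom 1 U * w) \<in> K"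
      using Q_mono pq by meson
    then have "\<forall>w. (p + q) * (monom 1 (max S T) * w) \<in> K"
      by (simp add: distrib_right K_add)
    then show ?thesis unfolding Q_def by blast
  qed
  have Q_smult: "Q (smult r p)" if "Q p" for r p
    using that K_smult unfolding Q_def by fastforce
  have Q_euler: "Q (euler p)" if Qp: "Q p" for p
  proof -
    obtain S where S: "\<And>w. p * (monom 1 S * w) \<in> K" using Qp unfolding Q_def by blast
    have "euler p * (monom 1 (n + S) * w) \<in> K" for w
    proof -
      let ?v = "monom 1 S * w"
      have m: "monom 1 (n + S) = monom 1 n * (monom 1 S :: complex poly)" by (simp add: mult_monom)
      \<comment> \<open>The Leibniz rule for [z^n, p v]: apart from the bracket itself, every term
        is a multiple of p z^S and hence in \<open>K\<close>.\<close>
      have "euler p * (monom 1 (n + S) * w) = witt_bracket (monom 1 n) (p * ?v)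
          - p * (monom 1 S * (monom 1 n * (smult (of_nat S) w + euler w)))
          + p * (monom 1 S * smult (of_nat n) (monom 1 n * w))"
        unfolding m by (simp add: witt_bracket_def euler_mult euler_monom algebra_simps smult_add_right)
      then show ?thesis by (simp only: K_add K_diff K_br_n S)
    qed
    then show ?thesis unfolding Q_def by blast
  qed
  obtain k where "Q (monom 1 k)"
    using euler_stable_contains_monom[of Q, OF Qa a(1) Q_euler Q_add Q_smult] by (rule exE)
  then obtain S where S: "\<And>w. monom 1 k * (monom 1 S * w) \<in> K" unfolding Q_def by blast
  have "d (int i) x = 0" if "k + S \<le> i" "x \<in> X" for i x
  proof -
    have "monom 1 i \<in> K"
      using S[of "monom 1 (i - (k + S))"] that by (simp add: mult_monom)
    then show ?thesis using that witt_op_monom[of 1 i x] by (simp add: K_def)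
  qed
  then show ?thesis by blast
qed

lemma high_modes_vanish:
  assumes "n > 0" and "locally_finite_op UNIV sc (d (int n))"
  shows "\<exists>M. \<forall>i\<ge>M. d (int i) x = 0"
proof -
  obtain B where B: "finite B" "B \<subseteq> orbit_span n x" "orbit_span n x = span B"
    using orbit_span_finite[OF assms(2)] .
  obtain C where C: "finite C" "\<And>i y. n < i \<Longrightarrow> y \<in> orbit_span n x \<Longrightarrow> d (int i) y \<in> span C"
    using higher_modes_finite_image[OF assms(2,1) B(1,3)] by metis
  have "x \<in> orbit_span n x"
    unfolding orbit_span_def by (rule span_base) (auto intro: range_eqI[of _ _ 0])
  then show ?thesis
    using high_modes_vanish_aux[OF orbit_span_stable B(1,2) equalityD1[OF B(3)] C] by blast
qed

end

subsection \<open>Submodules of the polynomial module\<close>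

lemma Fop_0 [simp]: "Fop \<alpha> h 0 = 0"
  by (simp add: Fop_def)

lemma Gop_0 [simp]: "Gop \<alpha> h 0 = 0"
  by (simp add: Gop_def)

lemma Fop_add: "Fop \<alpha> h (f + g) = Fop \<alpha> h f + Fop \<alpha> h g"
  by (simp add: Fop_def pderiv_add algebra_simps)

lemma Fop_smult: "Fop \<alpha> h (smult r f) = smult r (Fop \<alpha> h f)"
  by (simp add: Fop_def pderiv_smult smult_diff_right)

lemma Gop_add: "Gop \<alpha> h (f + g) = Gop \<alpha> h f + Gop \<alpha> h g"
  by (simp add: Gop_def Fop_add smult_add_right algebra_simps)

lemma Gop_smult: "Gop \<alpha> h (smult r f) = smult r (Gop \<alpha> h f)"
  by (simp add: Gop_def Fop_smult smult_add_right mult.commute)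

text \<open>F is a multiplication operator minus d/dt, so F t = t F - 1 as operators; this
  commutation gives the shift by \<open>f\<close>.\<close>

lemma Gop_Fop: "Gop \<alpha> h (Fop \<alpha> h f) = Fop \<alpha> h (Gop \<alpha> h f + f)"
  unfolding Gop_def by (simp add: Fop_def pderiv_add pderiv_diff pderiv_mult pderiv_smult
      pderiv_pCons smult_add_right smult_diff_right algebra_simps)

definition omega_term ::
    "complex \<Rightarrow> complex \<Rightarrow> complex poly \<Rightarrow> int \<Rightarrow> nat \<Rightarrow> complex poly \<Rightarrow> complex poly poly" where
  "omega_term lam \<alpha> h m i f = smult [:lam powi m:]
     ([:[:- of_int m:], 1:] ^ i *
       (pCons 0 [:f:] + [:smult (of_int m) (Gop \<alpha> h f) - smult (of_int m ^ 2 * \<alpha>) (Fop \<alpha> h f):]))"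

lemma omega_term_0 [simp]: "omega_term lam \<alpha> h m i 0 = 0"
  by (simp add: omega_term_def)

lemma omega_term_add:
  "omega_term lam \<alpha> h m i (f + g) = omega_term lam \<alpha> h m i f + omega_term lam \<alpha> h m i g"
proof -
  let ?a = "\<lambda>f. pCons 0 [:f:] +
      [:smult (of_int m) (Gop \<alpha> h f) - smult (of_int m ^ 2 * \<alpha>) (Fop \<alpha> h f):]"
  have "?a (f + g) = ?a f + ?a g"
    by (simp add: Gop_add Fop_add smult_add_right)
  then show ?thesis
    unfolding omega_term_def by (simp only: distrib_left smult_add_right)
qed

lemma omega_term_smult:
  "omega_term lam \<alpha> h m i (smult r f) = smult [:r:] (omega_term lam \<alpha> h m i f)"
proof -
  let ?a = "\<lambda>f. pCons 0 [:f:] +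
      [:smult (of_int m) (Gop \<alpha> h f) - smult (of_int m ^ 2 * \<alpha>) (Fop \<alpha> h f):]"
  have "?a (smult r f) = smult [:r:] (?a f)"
    by (simp add: Gop_smult Fop_smult smult_diff_right mult.commute)
  then show ?thesis
    unfolding omega_term_def by (simp only: mult_smult_right smult_smult mult.commute)
qed

lemma omega_d_atMost:
  assumes "degree P \<le> N"
  shows "omega_d lam \<alpha> h m P = (\<Sum>i\<le>N. omega_term lam \<alpha> h m i (coeff P i))"
  unfolding omega_d_def omega_term_def[symmetric] using assms
  by (intro sum.mono_neutral_left) (auto simp: coeff_eq_0)

lemma omega_d_add: "omega_d lam \<alpha> h m (P + Q) = omega_d lam \<alpha> h m P + omega_d lam \<alpha> h m Q"
proof -
  let ?N = "max (degree P) (degree Q)"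
  have "degree (P + Q) \<le> ?N" by (simp add: degree_add_le_max)
  then show ?thesis
    by (simp add: omega_d_atMost[of _ ?N] omega_term_add sum.distrib)
qed

lemma omega_d_smult: "omega_d lam \<alpha> h m (smult [:r:] P) = smult [:r:] (omega_d lam \<alpha> h m P)"
proof -
  have "smult [:r:] (\<Sum>i\<in>I. f i) = (\<Sum>i\<in>I. smult [:r:] (f i))"
    for I and f :: "nat \<Rightarrow> complex poly poly"
    by (rule poly_eqI) (simp add: coeff_sum sum_distrib_left)
  moreover have "degree (smult [:r:] P) \<le> degree P" by (rule degree_smult_le)
  ultimately show ?thesis
    by (simp add: omega_d_atMost[of _ "degree P"] omega_term_smult)
qed

lemma omega_d_0 [simp]: "omega_d lam \<alpha> h m 0 = 0"
  by (simp add: omega_d_atMost[of _ 0])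

lemma omega_d_sum: "omega_d lam \<alpha> h m (\<Sum>i\<in>I. f i) = (\<Sum>i\<in>I. omega_d lam \<alpha> h m (f i))"
  by (induction I rule: infinite_finite_induct) (auto simp: omega_d_add)

lemma omega_d_monom: "omega_d lam \<alpha> h m (monom f i) = omega_term lam \<alpha> h m i f"
proof -
  have "omega_d lam \<alpha> h m (monom f i) = (\<Sum>j\<le>i. if j = i then omega_term lam \<alpha> h m i f else 0)"
    by (subst omega_d_atMost[OF degree_monom_le], rule sum.cong) auto
  then show ?thesis by simp
qed

section \<open>Coordinates in the monomial basis\<close>

definition bicoeff :: "complex poly poly \<Rightarrow> nat \<times> nat \<Rightarrow> complex" where
  "bicoeff P q = coeff (coeff P (snd q)) (fst q)"

abbreviation bimonom :: "nat \<times> nat \<Rightarrow> complex poly poly" where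
  "bimonom p \<equiv> monom (monom 1 (fst p)) (snd p)"

lemma bicoeff_add: "bicoeff (P + Q) q = bicoeff P q + bicoeff Q q"
  and bicoeff_smult: "bicoeff (smult [:r:] P) q = r * bicoeff P q"
  and bicoeff_0 [simp]: "bicoeff 0 q = 0"
  and bicoeff_sum: "bicoeff (\<Sum>i\<in>I. f i) q = (\<Sum>i\<in>I. bicoeff (f i) q)"
  by (simp_all add: bicoeff_def coeff_sum)

lemma bicoeff_bimonom: "bicoeff (bimonom p) q = (if p = q then 1 else 0)"
  by (auto simp: bicoeff_def prod_eq_iff)

lemma bicoeff_eqI: "(\<And>q. bicoeff P q = bicoeff Q q) \<Longrightarrow> P = Q"
  unfolding bicoeff_def by (intro poly_eqI) (metis fst_conv snd_conv)

lemma finite_bicoeff: "finite {q. bicoeff P q \<noteq> 0}"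
proof (rule finite_subset)
  show "{q. bicoeff P q \<noteq> 0} \<subseteq> (\<Union>j\<le>degree P. {..degree (coeff P j)} \<times> {j})"
    by (force simp: bicoeff_def intro: le_degree)
qed auto

lemma bimonom_expansion:
  assumes "finite S" "\<And>q. q \<notin> S \<Longrightarrow> bicoeff P q = 0"
  shows "P = (\<Sum>p\<in>S. smult [:bicoeff P p:] (bimonom p))"
proof (rule bicoeff_eqI)
  fix q
  have "(\<Sum>p\<in>S. bicoeff P p * (if p = q then 1 else 0)) = (\<Sum>p\<in>S. if p = q then bicoeff P q else 0)"
    by (rule sum.cong) auto
  then show "bicoeff P q = bicoeff (\<Sum>p\<in>S. smult [:bicoeff P p:] (bimonom p)) q"
    using assms by (simp add: bicoeff_sum bicoeff_smult bicoeff_bimonom)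
qed

lemma omega_coeff_bicoeff: "omega_coeff lam \<alpha> h m p q = bicoeff (omega_d lam \<alpha> h m (bimonom p)) q"
  by (simp add: omega_coeff_def bicoeff_def)

lemma bicoeff_omega_d:
  assumes "finite S" "\<And>q. q \<notin> S \<Longrightarrow> bicoeff P q = 0"
  shows "bicoeff (omega_d lam \<alpha> h m P) q = (\<Sum>p\<in>S. omega_coeff lam \<alpha> h m p q * bicoeff P p)"
  by (subst bimonom_expansion[OF assms], assumption)
    (simp add: omega_d_sum omega_d_smult bicoeff_sum bicoeff_smult omega_coeff_bicoeff mult.commute)

text \<open>Multiplying by s or s - m only recombines coefficients linearly, so stability under G
  and \<alpha> F suffices. Asking for \<alpha> F instead of F admits subspaces that are not F-stable
  when \<open>\<alpha> = 0\<close>.\<close>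

lemma omega_submodule_coeffs:
  fixes W :: "complex poly set"
  assumes W: "0 \<in> W" "\<And>f g. f \<in> W \<Longrightarrow> g \<in> W \<Longrightarrow> f + g \<in> W" "\<And>r f. f \<in> W \<Longrightarrow> smult r f \<in> W"
    and G: "\<And>f. f \<in> W \<Longrightarrow> Gop \<alpha> h f \<in> W" and F: "\<And>f. f \<in> W \<Longrightarrow> smult \<alpha> (Fop \<alpha> h f) \<in> W"
  shows "vir_submodule UNIV omega_sc (omega_d lam \<alpha> h) omega_c {P. \<forall>i. coeff P i \<in> W}"
proof -
  let ?X = "{P. \<forall>i. coeff P i \<in> W}"
  have add: "P + Q \<in> ?X" if "P \<in> ?X" "Q \<in> ?X" for P Q using that W(2) by simp
  have scale: "smult [:r:] P \<in> ?X" if "P \<in> ?X" for r P using that W(3) by simp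
  have shift: "pCons 0 P \<in> ?X" if "P \<in> ?X" for P using that W(1) by (simp add: coeff_pCons split: nat.split)
  have const: "[:f:] \<in> ?X" if "f \<in> W" for f using that W(1) by (simp add: coeff_pCons split: nat.split)
  have pow: "[:[:r:], 1:] ^ i * P \<in> ?X" if "P \<in> ?X" for r i P
  proof (induction i)
    case (Suc i)
    have "[:[:r:], 1:] ^ Suc i * P = smult [:r:] ([:[:r:], 1:] ^ i * P) + pCons 0 ([:[:r:], 1:] ^ i * P)"
      by (simp add: distrib_right)
    then show ?case using add[OF scale[OF Suc] shift[OF Suc]] by metis
  qed (use that in simp)
  have omega_term: "omega_term lam \<alpha> h m i f \<in> ?X" if "f \<in> W" for m i f
  proof -
    have "smult (of_int m ^ 2 * \<alpha>) (Fop \<alpha> h f) = smult (of_int m ^ 2) (smult \<alpha> (Fop \<alpha> h f))"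
      by simp
    moreover have "f - g \<in> W" if "f \<in> W" "g \<in> W" for f g
      using W(2)[OF that(1) W(3)[OF that(2), of "-1"]] by simp
    ultimately have "smult (of_int m) (Gop \<alpha> h f) - smult (of_int m ^ 2 * \<alpha>) (Fop \<alpha> h f) \<in> W"
      using W(3) G F that by metis
    then show ?thesis
      unfolding omega_term_def using that by (intro scale pow add shift const)
  qed
  have zero: "0 \<in> ?X" using W(1) by simp
  have "omega_d lam \<alpha> h m P \<in> ?X" if "P \<in> ?X" for m P
  proof -
    have "(\<Sum>i\<le>N. omega_term lam \<alpha> h m i (coeff P i)) \<in> ?X" for N
    proof (induction N)
      case 0
      show ?case using that by (simp only: atMost_0 sum.insert_remove) (use omega_term that in simp)
    next
      case (Suc N)
      have "omega_term lam \<alpha> h m (Suc N) (coeff P (Suc N)) \<in> ?X" using that by (intro omega_term) simp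
      from add[OF Suc this] show ?case by simp
    qed
    then show ?thesis by (simp only: omega_d_atMost[OF order_refl])
  qed
  then show ?thesis
    using add scale zero unfolding vir_submodule_def omega_sc_def omega_c_def by blast
qed

lemma omega_irreducible_imp_trivial_coeffs:
  assumes "vir_irreducible UNIV omega_sc (omega_d lam \<alpha> h) omega_c"
    and W: "0 \<in> W" "\<And>f g. f \<in> W \<Longrightarrow> g \<in> W \<Longrightarrow> f + g \<in> W" "\<And>r f. f \<in> W \<Longrightarrow> smult r f \<in> W"
    and "\<And>f. f \<in> W \<Longrightarrow> Gop \<alpha> h f \<in> W" "\<And>f. f \<in> W \<Longrightarrow> smult \<alpha> (Fop \<alpha> h f) \<in> W"
    and "w \<in> W" "w \<noteq> 0"
  shows "f \<in> W"
proof -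
  have "{P. \<forall>i. coeff P i \<in> W} = {0} \<or> {P. \<forall>i. coeff P i \<in> W} = (UNIV :: complex poly poly set)"
    using omega_submodule_coeffs[OF W assms(5,6), of lam] assms(1)
    unfolding vir_irreducible_def by blast
  moreover have "[:w:] \<in> {P. \<forall>i. coeff P i \<in> W}"
    using assms by (simp add: coeff_pCons split: nat.split)
  moreover have "[:w:] \<noteq> 0" using \<open>w \<noteq> 0\<close> by simp
  ultimately have "[:f:] \<in> {P. \<forall>i. coeff P i \<in> W}" by blast
  then have "coeff [:f:] 0 \<in> W" by blast
  then show ?thesis by simp
qed

section \<open>Reducibility unless h is linear and \<alpha> nonzero\<close>

lemma divided_difference_mult:
  "[:- \<alpha>, 1:] * ((h - [:poly h \<alpha>:]) div [:- \<alpha>, 1:]) = h - [:poly h \<alpha> :: complex:]"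
  by (rule dvd_mult_div_cancel) (simp flip: poly_eq_0_iff_dvd)

lemma degree_divided_difference:
  "degree h = Suc n \<Longrightarrow> degree ((h - [:poly h \<alpha>:]) div [:- \<alpha>, 1:]) = n"
  for h :: "complex poly"
proof -
  let ?g = "(h - [:poly h \<alpha>:]) div [:- \<alpha>, 1:]"
  assume h: "degree h = Suc n"
  then have "degree (h - [:poly h \<alpha>:]) = Suc n"
    using degree_add_eq_left[of "- [:poly h \<alpha>:]" h] unfolding diff_conv_add_uminus by simp
  then have d: "degree ([:- \<alpha>, 1:] * ?g) = Suc n" by (simp only: divided_difference_mult)
  then have "?g \<noteq> 0" by (metis degree_0 mult_zero_right nat.distinct(1))
  then show ?thesis using d by (subst (asm) degree_mult_eq) auto
qed

lemma omega_irreducible_imp: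
  assumes irr: "vir_irreducible UNIV omega_sc (omega_d lam \<alpha> h) omega_c"
  shows "degree h = 1 \<and> \<alpha> \<noteq> 0"
proof (rule ccontr)
  assume neg: "\<not> (degree h = 1 \<and> \<alpha> \<noteq> 0)"
  consider "\<alpha> = 0" | "degree h = 0" | n where "degree h = Suc (Suc n)"
    using neg by (metis One_nat_def not0_implies_Suc)
  then show False
  proof cases
    case 1
    \<comment> \<open>For \<open>\<alpha> = 0\<close> the value of G f at 0 is h(0) f(0), so
      vanishing at 0 is preserved by G.\<close>
    have "1 \<in> {f :: complex poly. poly f 0 = 0}"
      by (rule omega_irreducible_imp_trivial_coeffs[OF irr, where w = "[:0, 1:]"])
        (auto simp: 1 Gop_def)
    then show False by simp
  next
    case 2
    then obtain a where "h = [:a:]" by (rule degree_eq_zeroE)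
    then have F: "Fop \<alpha> h f = - pderiv f" for f by (simp add: Fop_def)
    \<comment> \<open>F annihilates constants, so G acts on them as the scalar h(\<alpha>).\<close>
    have "[:0, 1:] \<in> range (\<lambda>a :: complex. [:a:])"
      by (rule omega_irreducible_imp_trivial_coeffs[OF irr, where w = 1])
        (auto simp: Gop_def F pderiv_pCons one_pCons)
    then show False by auto
  next
    case 3
    let ?g = "(h - [:poly h \<alpha>:]) div [:- \<alpha>, 1:]"
    have g: "degree ?g = Suc n" using degree_divided_difference 3 by blast
    \<comment> \<open>Since \<open>?g\<close> has positive degree, \<open>?g * f\<close> outweighs
      the derivative. F thus raises degrees and cannot take the value 1.\<close>
    have F: "degree (Fop \<alpha> h f) \<ge> Suc n" if "f \<noteq> 0" for f
    proof -
      have "?g \<noteq> 0" using g by force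
      then have deg: "degree (?g * f) = Suc n + degree f" using g that by (simp add: degree_mult_eq)
      then have "degree (- pderiv f) < degree (?g * f)"
        using degree_pderiv[of f] by simp
      then have "degree (Fop \<alpha> h f) = Suc n + degree f"
        unfolding Fop_def using degree_add_eq_left[of "- pderiv f" "?g * f"] deg by simp
      then show ?thesis by simp
    qed
    have "1 \<in> range (Fop \<alpha> h)"
    proof (rule omega_irreducible_imp_trivial_coeffs[OF irr, where w = "Fop \<alpha> h 1"])
      show "0 \<in> range (Fop \<alpha> h)" by (metis Fop_0 rangeI)
      show "f + g \<in> range (Fop \<alpha> h)" if "f \<in> range (Fop \<alpha> h)" "g \<in> range (Fop \<alpha> h)" for f g
        using that by (auto simp flip: Fop_add)
      show "smult r f \<in> range (Fop \<alpha> h)" if "f \<in> range (Fop \<alpha> h)" for r f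
        using that by (auto simp flip: Fop_smult)
      show "Gop \<alpha> h f \<in> range (Fop \<alpha> h)" if "f \<in> range (Fop \<alpha> h)" for f
        using that by (auto simp: Gop_Fop)
      show "smult \<alpha> (Fop \<alpha> h f) \<in> range (Fop \<alpha> h)" for f
        by (simp flip: Fop_smult)
      show "Fop \<alpha> h 1 \<noteq> 0" using F[of 1] by force
    qed simp
    then obtain f where f: "Fop \<alpha> h f = 1" by (metis rangeE)
    then have "f \<noteq> 0" by force
    then show False using F[of f] f by simp
  qed
qed

section \<open>From the tensor product to its polynomial factor\<close>

context vir_module
begin

text \<open>Take the coordinate at \<open>v\<close> in a basis extending \<open>{v}\<close>.\<close>

lemma exists_linear_functional:
  assumes "v \<noteq> 0"
  obtains \<phi> :: "'v \<Rightarrow> complex" where "\<And>x y. \<phi> (x + y) = \<phi> x + \<phi> y" "\<And>r x. \<phi> (sc r x) = r * \<phi> x"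
    "\<phi> v = 1"
proof -
  have ind: "independent {v}" using assms by simp
  let ?B = "extend_basis {v}"
  have B: "independent ?B" "span ?B = UNIV" "v \<in> ?B"
    using ind extend_basis_superset[OF ind] by (auto simp: independent_extend_basis)
  show ?thesis
  proof (rule that[of "\<lambda>x. representation ?B x v"])
    show "representation ?B (x + y) v = representation ?B x v + representation ?B y v" for x y
      using representation_add[OF B(1)] B(2) by simp
    show "representation ?B (sc r x) v = r * representation ?B x v" for r x
      using representation_scale[OF B(1)] B(2) by simp
    show "representation ?B v v = 1"
      using representation_basis[OF B(1,3)] by simp
  qed
qed

lemma tens_d_support_finite:
  assumes "F \<in> tens_carrier"
  shows "tens_d lam \<alpha> h sc d m F \<in> tens_carrier"
proof -
  let ?S = "{p. F p \<noteq> 0}"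
  let ?A = "(\<Union>p\<in>?S. {q. omega_coeff lam \<alpha> h m p q \<noteq> 0}) \<union> ?S"
  have fin: "finite ?S" using assms by (simp add: tens_carrier_def)
  have "tens_d lam \<alpha> h sc d m F q = 0" if "q \<notin> ?A" for q
  proof -
    have "(\<Sum>p\<in>?S. sc (omega_coeff lam \<alpha> h m p q) (F p)) = 0"
      using that by (intro sum.neutral ballI) auto
    then show ?thesis using that by (simp add: tens_d_def d_zero)
  qed
  then have "{q. tens_d lam \<alpha> h sc d m F q \<noteq> 0} \<subseteq> ?A" by blast
  moreover have "finite ?A" using fin by (simp add: omega_coeff_bicoeff finite_bicoeff)
  ultimately show ?thesis unfolding tens_carrier_def using finite_subset by blast
qed

text \<open>The submodule \<open>W \<otimes> V\<close> of \<open>\<Omega> \<otimes> V\<close> is cut out by the conditions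
  \<open>(1 \<otimes> \<phi>) F \<in> W\<close> for all linear functionals \<open>\<phi>\<close> on \<open>V\<close>, and \<open>\<phi> \<circ> d_m\<close> is again such a functional.\<close>

lemma tensor_irreducible_imp_omega_irreducible:
  fixes v :: 'v
  assumes "v \<noteq> 0"
    and irr: "vir_irreducible tens_carrier (tens_sc sc) (tens_d lam \<alpha> h sc d) (tens_c c)"
  shows "vir_irreducible UNIV omega_sc (omega_d lam \<alpha> h) omega_c"
  unfolding vir_irreducible_def
proof (intro conjI allI impI)
  show "UNIV \<noteq> {0 :: complex poly poly}" by (metis UNIV_I one_neq_zero singletonD)
  fix W assume "vir_submodule UNIV omega_sc (omega_d lam \<alpha> h) omega_c W"
  then have W: "0 \<in> W" "\<And>P Q. P \<in> W \<Longrightarrow> Q \<in> W \<Longrightarrow> P + Q \<in> W"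
    "\<And>r P. P \<in> W \<Longrightarrow> smult [:r:] P \<in> W" "\<And>i P. P \<in> W \<Longrightarrow> omega_d lam \<alpha> h i P \<in> W"
    unfolding vir_submodule_def omega_sc_def by auto
  define lin where "lin \<phi> \<longleftrightarrow> (\<forall>x y. \<phi> (x + y) = \<phi> x + \<phi> y) \<and> (\<forall>r x. \<phi> (sc r x) = r * \<phi> x)"
    for \<phi> :: "'v \<Rightarrow> complex"
  define X where "X = {F \<in> tens_carrier. \<forall>\<phi>. lin \<phi> \<longrightarrow> (\<exists>P\<in>W. \<forall>q. \<phi> (F q) = bicoeff P q)}"
  have lin_0: "\<phi> 0 = 0" if "lin \<phi>" for \<phi>
    using that scale_zero_left[of 0] unfolding lin_def by (metis mult_zero_left)
  have lin_sum: "\<phi> (\<Sum>i\<in>I. f i) = (\<Sum>i\<in>I. \<phi> (f i))" if "lin \<phi>" for \<phi> I and f :: "nat \<times> nat \<Rightarrow> 'v"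
    using that lin_0[OF that] by (induction I rule: infinite_finite_induct) (auto simp: lin_def)
  have pure: "(\<lambda>q. sc (bicoeff P q) v) \<in> tens_carrier" for P
    unfolding tens_carrier_def using finite_bicoeff[of P]
    by (auto elim!: rev_finite_subset)
  have "vir_submodule tens_carrier (tens_sc sc) (tens_d lam \<alpha> h sc d) (tens_c c) X"
    unfolding vir_submodule_def
  proof (intro conjI ballI allI)
    show "X \<subseteq> tens_carrier" by (auto simp: X_def)
    show "0 \<in> X" using W(1) by (auto simp: X_def tens_carrier_def lin_0 intro!: bexI[of _ 0])
    fix F assume F: "F \<in> X"
    then have fin: "finite {p. F p \<noteq> 0}" by (simp add: X_def tens_carrier_def)
    have FP: "\<exists>P\<in>W. \<forall>q. \<phi> (F q) = bicoeff P q" if "lin \<phi>" for \<phi>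
      using F that by (simp add: X_def)
    {
      fix G assume G: "G \<in> X"
      have "finite {p. (F + G) p \<noteq> 0}"
        by (rule finite_subset[of _ "{p. F p \<noteq> 0} \<union> {p. G p \<noteq> 0}"])
          (use fin G in \<open>auto simp: X_def tens_carrier_def\<close>)
      moreover have "\<exists>P\<in>W. \<forall>q. \<phi> ((F + G) q) = bicoeff P q" if "lin \<phi>" for \<phi>
      proof -
        obtain P where P: "P \<in> W" "\<forall>q. \<phi> (F q) = bicoeff P q" using FP[OF \<open>lin \<phi>\<close>] by blast
        obtain Q where Q: "Q \<in> W" "\<forall>q. \<phi> (G q) = bicoeff Q q"
          using G \<open>lin \<phi>\<close> by (auto simp: X_def)
        have "\<forall>q. \<phi> ((F + G) q) = bicoeff (P + Q) q"
          using P Q \<open>lin \<phi>\<close> by (simp add: bicoeff_add lin_def)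
        then show ?thesis using W(2) P(1) Q(1) by blast
      qed
      ultimately show "F + G \<in> X" by (simp add: X_def tens_carrier_def)
    }
    show "tens_sc sc r F \<in> X" for r
    proof -
      have "finite {p. tens_sc sc r F p \<noteq> 0}"
        by (rule finite_subset[OF _ fin]) (auto simp: tens_sc_def)
      moreover have "\<exists>P\<in>W. \<forall>q. \<phi> (tens_sc sc r F q) = bicoeff P q" if "lin \<phi>" for \<phi>
      proof -
        obtain P where P: "P \<in> W" "\<forall>q. \<phi> (F q) = bicoeff P q" using FP[OF \<open>lin \<phi>\<close>] by blast
        have "\<forall>q. \<phi> (tens_sc sc r F q) = bicoeff (smult [:r:] P) q"
          using P \<open>lin \<phi>\<close> by (simp add: tens_sc_def lin_def bicoeff_smult)
        then show ?thesis using W(3) P(1) by blast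
      qed
      ultimately show ?thesis by (simp add: X_def tens_carrier_def)
    qed
    show "tens_c c F \<in> X"
    proof -
      have "finite {p. tens_c c F p \<noteq> 0}"
        by (rule finite_subset[OF _ fin]) (auto simp: tens_c_def c_zero)
      moreover have "\<exists>P\<in>W. \<forall>q. \<phi> (tens_c c F q) = bicoeff P q" if "lin \<phi>" for \<phi>
        using FP[of "\<lambda>x. \<phi> (c x)"] that by (simp add: tens_c_def lin_def c_add c_scale)
      ultimately show ?thesis by (simp add: X_def tens_carrier_def)
    qed
    show "tens_d lam \<alpha> h sc d m F \<in> X" for m
    proof -
      have "\<exists>P\<in>W. \<forall>q. \<phi> (tens_d lam \<alpha> h sc d m F q) = bicoeff P q" if \<phi>: "lin \<phi>" for \<phi>
      proof -
        obtain P where P: "P \<in> W" "\<And>q. \<phi> (F q) = bicoeff P q" using FP[OF \<phi>] by blast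
        have "lin (\<lambda>x. \<phi> (d m x))" using \<phi> by (simp add: lin_def d_add d_scale)
        from FP[OF this] obtain Q where Q: "Q \<in> W" "\<And>q. \<phi> (d m (F q)) = bicoeff Q q" by blast
        have "\<phi> (tens_d lam \<alpha> h sc d m F q) = bicoeff (omega_d lam \<alpha> h m P + Q) q" for q
        proof -
          have "bicoeff (omega_d lam \<alpha> h m P) q =
              (\<Sum>p\<in>{p. F p \<noteq> 0}. omega_coeff lam \<alpha> h m p q * bicoeff P p)"
            using fin by (rule bicoeff_omega_d) (simp add: lin_0[OF \<phi>] flip: P(2))
          also have "\<dots> = \<phi> (\<Sum>p\<in>{p. F p \<noteq> 0}. sc (omega_coeff lam \<alpha> h m p q) (F p))"
            using \<phi> by (simp add: lin_sum[OF \<phi>] P(2)[symmetric]) (simp add: lin_def)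
          finally show ?thesis
            using \<phi> Q(2) by (simp add: tens_d_def bicoeff_add lin_def)
        qed
        then show ?thesis using W(2,4) P(1) Q(1) by blast
      qed
      then show ?thesis using tens_d_support_finite F by (simp add: X_def)
    qed
  qed
  then have X: "X = {0} \<or> X = tens_carrier" using irr by (simp add: vir_irreducible_def)
  show "W = {0} \<or> W = UNIV"
  proof (cases "W = {0}")
    case False
    then obtain P where P: "P \<in> W" "P \<noteq> 0" using W(1) by blast
    \<comment> \<open>The tensor of \<open>P\<close> and \<open>v\<close>, witnessing that
      \<open>X\<close> is nonzero.\<close>
    let ?F = "\<lambda>q. sc (bicoeff P q) v"
    have "?F \<in> X"
      unfolding X_def
    proof (intro CollectI conjI allI impI)
      fix \<phi> assume "lin \<phi>"
      then have "\<forall>q. \<phi> (?F q) = bicoeff (smult [:\<phi> v:] P) q"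
        by (simp add: lin_def bicoeff_smult mult.commute)
      then show "\<exists>P\<in>W. \<forall>q. \<phi> (?F q) = bicoeff P q" using W(3) P(1) by blast
    qed (rule pure)
    moreover have "?F \<noteq> 0"
    proof
      assume "?F = 0"
      then have "sc (bicoeff P q) v = 0" for q by (metis zero_fun_apply)
      then have "bicoeff P q = 0" for q using \<open>v \<noteq> 0\<close> by simp
      then show False using P(2) bicoeff_eqI[of P 0] by simp
    qed
    ultimately have X: "X = tens_carrier" using X by blast
    \<comment> \<open>Such a functional, applied to the tensor of Q and \<open>v\<close>, returns
      Q.\<close>
    obtain \<phi> where \<phi>: "lin \<phi>" "\<phi> v = 1"
      using exists_linear_functional[OF \<open>v \<noteq> 0\<close>] unfolding lin_def by metis
    have "Q \<in> W" for Q
    proof -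
      have "(\<lambda>q. sc (bicoeff Q q) v) \<in> X" unfolding X by (rule pure)
      then obtain R where R: "R \<in> W" "\<And>q. \<phi> (sc (bicoeff Q q) v) = bicoeff R q"
        using \<phi>(1) unfolding X_def by blast
      then have "bicoeff Q q = bicoeff R q" for q using \<phi> by (simp add: lin_def)
      then show ?thesis using R(1) bicoeff_eqI by metis
    qed
    then show ?thesis by blast
  qed simp
qed

end

subsection \<open>Polynomial dependence on the mode\<close>

text \<open>For a polynomial p of degree at most n + 1, the combination 2^(n+1) p(k) - p(2k) loses
  its top term and multiplies the l-th coefficient by 2^(n+1) - 2^l, which is nonzero for lower l.
  Induction gives the lower coefficients; subtracting them isolates the top one.\<close>

lemma subspace_polynomial_coeff:
  fixes scale :: "complex \<Rightarrow> 'b::ab_group_add \<Rightarrow> 'b"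
  assumes "vector_space scale" and W: "module.subspace scale W"
    and "\<And>k. k \<ge> K \<Longrightarrow> (\<Sum>l\<le>n. scale (of_nat k ^ l) (w l)) \<in> W"
    and "l \<le> n"
  shows "w l \<in> W"
proof -
  interpret vector_space scale by fact
  have cancel: "x \<in> W" if "scale r x \<in> W" "r \<noteq> 0" for r x
    using subspace_scale[OF W that(1), of "inverse r"] that(2) by simp
  show ?thesis
    using assms(3,4)
  proof (induction n arbitrary: w l)
    case 0
    then show ?case using "0.prems"(1)[of K] by simp
  next
    case (Suc n)
    let ?p = "\<lambda>k. \<Sum>l\<le>Suc n. scale (of_nat k ^ l) (w l)"
    have low: "w l \<in> W" if "l \<le> n" for l
    proof -
      have "(\<Sum>l\<le>n. scale (of_nat k ^ l) (scale (2 ^ Suc n - 2 ^ l) (w l))) \<in> W" if "k \<ge> K" for k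
      proof -
        have "scale (2 ^ Suc n) (?p k) - ?p (2 * k) \<in> W"
          using that by (intro subspace_diff subspace_scale W Suc.prems(1)) auto
        also have "scale (2 ^ Suc n) (?p k) - ?p (2 * k) =
            (\<Sum>l\<le>Suc n. scale (of_nat k ^ l) (scale (2 ^ Suc n - 2 ^ l) (w l)))"
          unfolding scale_sum_right sum_subtractf[symmetric]
          by (intro sum.cong) (simp_all add: power_mult_distrib right_diff_distrib mult_ac
              flip: scale_left_diff_distrib)
        finally show ?thesis by simp
      qed
      from Suc.IH[OF this \<open>l \<le> n\<close>] have "scale (2 ^ Suc n - 2 ^ l) (w l) \<in> W" .
      moreover have "(2 :: complex) ^ Suc n \<noteq> 2 ^ l"
      proof
        assume "(2 :: complex) ^ Suc n = 2 ^ l"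
        then have "of_nat (2 ^ Suc n) = (of_nat (2 ^ l) :: complex)" by simp
        then have "(2 :: nat) ^ Suc n = 2 ^ l" by (simp only: of_nat_eq_iff)
        then show False using that power_inject_exp[of "2 :: nat" "Suc n" l] by simp
      qed
      ultimately show ?thesis using cancel by simp
    qed
    show ?case
    proof (cases "l = Suc n")
      case True
      \<comment> \<open>\<open>Suc K\<close> is both beyond the threshold and nonzero, so its power
        can be cancelled.\<close>
      let ?k = "Suc K"
      have "?p ?k - (\<Sum>l\<le>n. scale (of_nat ?k ^ l) (w l)) \<in> W"
        using low by (intro subspace_diff subspace_sum subspace_scale W Suc.prems(1)) auto
      then have "scale (of_nat ?k ^ Suc n) (w (Suc n)) \<in> W" by simp
      then show ?thesis using cancel True by (metis of_nat_neq_0 power_not_zero)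
    qed (use low Suc.prems(2) in simp)
  qed
qed

text \<open>\<open>shift_coeff i k\<close> is the coefficient of \<open>m\<^sup>k\<close> in \<open>(s - m)\<^sup>i\<close>, and \<open>omega_mode \<alpha> h l i f\<close> the
  coefficient of \<open>m\<^sup>l\<close> in \<open>\<lambda>\<^sup>-\<^sup>m d_m(f s\<^sup>i)\<close>.\<close>

definition shift_coeff :: "nat \<Rightarrow> nat \<Rightarrow> complex poly poly" where
  "shift_coeff i k = monom [:(- 1) ^ k * of_nat (i choose k):] (i - k)"

text \<open>The binomial theorem. The limit \<open>N\<close> may exceed \<open>i\<close> because the
  extra binomial coefficients vanish; one range then serves all s-degrees.\<close>

lemma shift_power:
  fixes m :: complex
  assumes "i \<le> N"
  shows "[:[:- m:], 1:] ^ i = (\<Sum>k\<le>N. smult [:m ^ k:] (shift_coeff i k))"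
proof -
  have c: "[:[:r:]:] ^ k = [:[:r ^ k:]:]" for r :: complex and k
    by (induction k) (simp_all add: one_pCons)
  have "[:[:- m:], 1:] ^ i = ([:[:- m:]:] + monom 1 1) ^ i" by (simp add: monom_altdef)
  also have "\<dots> = (\<Sum>k\<le>i. smult [:m ^ k:] (shift_coeff i k))"
    unfolding binomial_ring
  proof (intro sum.cong refl)
    fix k
    have "(- m) ^ k = (- 1) ^ k * m ^ k" by (simp flip: power_mult_distrib)
    then show "of_nat (i choose k) * [:[:- m:]:] ^ k * monom 1 1 ^ (i - k) =
        smult [:m ^ k:] (shift_coeff i k)"
      unfolding c shift_coeff_def
      by (simp add: monom_power of_nat_poly smult_monom mult_ac)
  qed
  also have "\<dots> = (\<Sum>k\<le>N. smult [:m ^ k:] (shift_coeff i k))"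
    using assms by (intro sum.mono_neutral_left) (auto simp: shift_coeff_def)
  finally show ?thesis .
qed

definition omega_mode ::
    "complex \<Rightarrow> complex poly \<Rightarrow> nat \<Rightarrow> nat \<Rightarrow> complex poly \<Rightarrow> complex poly poly" where
  "omega_mode \<alpha> h l i f = shift_coeff i l * pCons 0 [:f:] +
     (case l of 0 \<Rightarrow> 0 | Suc k \<Rightarrow> shift_coeff i k * [:Gop \<alpha> h f:]) -
     (case l of Suc (Suc k) \<Rightarrow> shift_coeff i k * [:smult \<alpha> (Fop \<alpha> h f):] | _ \<Rightarrow> 0)"

text \<open>The factors m and m^2 in front of G and F move their contributions up by one and two
  places, whence the case distinctions in \<open>omega_mode\<close> and the limit N + 2.\<close>

lemma omega_term_modes:
  assumes "i \<le> N"
  shows "omega_term lam \<alpha> h m i f =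
    smult [:lam powi m:] (\<Sum>l\<le>Suc (Suc N). smult [:of_int m ^ l:] (omega_mode \<alpha> h l i f))"
proof -
  let ?m = "of_int m :: complex"
  let ?P = "[:[:- ?m:], 1:] ^ i"
  have "(\<Sum>l\<le>Suc (Suc N). smult [:?m ^ l:] (shift_coeff i l * pCons 0 [:f:])) = ?P * pCons 0 [:f:]"
    unfolding shift_power[OF le_SucI[OF le_SucI[OF assms]]] by (simp only: sum_distrib_right mult_smult_left)
  moreover have "(\<Sum>l\<le>Suc (Suc N). smult [:?m ^ l:]
      (case l of 0 \<Rightarrow> 0 | Suc k \<Rightarrow> shift_coeff i k * [:Gop \<alpha> h f:])) = ?P * [:smult ?m (Gop \<alpha> h f):]"
  proof -
    have "?P * [:smult ?m (Gop \<alpha> h f):] = (\<Sum>k\<le>Suc N. smult [:?m ^ Suc k:] (shift_coeff i k * [:Gop \<alpha> h f:]))"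
      unfolding shift_power[OF le_SucI[OF assms]] sum_distrib_right
      by (intro sum.cong refl) (simp add: mult_ac)
    then show ?thesis by (subst sum.atMost_Suc_shift) simp
  qed
  moreover have "(\<Sum>l\<le>Suc (Suc N). smult [:?m ^ l:]
      (case l of Suc (Suc k) \<Rightarrow> shift_coeff i k * [:smult \<alpha> (Fop \<alpha> h f):] | _ \<Rightarrow> 0)) =
      ?P * [:smult (?m ^ 2 * \<alpha>) (Fop \<alpha> h f):]"
  proof -
    have "?P * [:smult (?m ^ 2 * \<alpha>) (Fop \<alpha> h f):] =
        (\<Sum>k\<le>N. smult [:?m ^ Suc (Suc k):] (shift_coeff i k * [:smult \<alpha> (Fop \<alpha> h f):]))"
      unfolding shift_power[OF assms] sum_distrib_right
      by (intro sum.cong refl) (simp add: mult_ac power2_eq_square)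
    then show ?thesis by (subst sum.atMost_Suc_shift, subst sum.atMost_Suc_shift) simp
  qed
  moreover have const_diff: "[:a - b:] = [:a:] - [:b:]" for a b :: "complex poly" by simp
  ultimately have "(\<Sum>l\<le>Suc (Suc N). smult [:?m ^ l:] (omega_mode \<alpha> h l i f)) =
      ?P * pCons 0 [:f:] + ?P * [:smult ?m (Gop \<alpha> h f):] - ?P * [:smult (?m ^ 2 * \<alpha>) (Fop \<alpha> h f):]"
    unfolding omega_mode_def smult_diff_right smult_add_right sum_subtractf sum.distrib by simp
  also have "\<dots> = ?P * (pCons 0 [:f:] + [:smult ?m (Gop \<alpha> h f) - smult (?m ^ 2 * \<alpha>) (Fop \<alpha> h f):])"
    unfolding const_diff by (simp only: distrib_left right_diff_distrib add_diff_eq)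
  finally show ?thesis unfolding omega_term_def by simp
qed

lemma omega_mode_0: "omega_mode \<alpha> h 0 i f = monom f (Suc i)"
  by (simp add: omega_mode_def shift_coeff_def monom_Suc mult_monom flip: monom_0)

text \<open>For s-degree at most \<open>N\<close>, the power m^(N+2) arises only from m^2 \<alpha> F
  times (-m)^N, which needs s-degree exactly \<open>N\<close>.\<close>

lemma omega_mode_top:
  assumes "i \<le> N"
  shows "omega_mode \<alpha> h (Suc (Suc N)) i f =
    (if i = N then [:smult (- ((- 1) ^ N * \<alpha>)) (Fop \<alpha> h f):] else 0)"
  using assms by (auto simp: omega_mode_def shift_coeff_def monom_0 binomial_eq_0)

lemma omega_mode_1_0: "omega_mode \<alpha> h 1 0 f = [:Gop \<alpha> h f:]"
  by (simp add: omega_mode_def shift_coeff_def monom_0)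

section \<open>Explicit modes for linear h\<close>

lemma Fop_degree_1:
  assumes "degree h = 1"
  shows "Fop \<alpha> h f = smult (coeff h 1) f - pderiv f"
proof -
  let ?g = "(h - [:poly h \<alpha>:]) div [:- \<alpha>, 1:]"
  obtain b where g: "?g = [:b:]"
    using degree_divided_difference[of h 0 \<alpha>] assms by (auto elim: degree_eq_zeroE)
  have "coeff ([:- \<alpha>, 1:] * ?g) 1 = coeff h 1"
    unfolding divided_difference_mult by simp
  then have "?g = [:coeff h 1:]" unfolding g by simp
  then show ?thesis by (simp add: Fop_def)
qed

lemma coeff_Fop_monom:
  "degree h = 1 \<Longrightarrow> coeff (Fop \<alpha> h (monom 1 a)) b =
     (if a = b then coeff h 1 else 0) - (if a = Suc b then of_nat a else 0)"
  by (auto simp: Fop_degree_1 coeff_pderiv)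

lemma coeff_Gop_monom:
  "degree h = 1 \<Longrightarrow> coeff (Gop \<alpha> h (monom 1 a)) b =
     (if a = b then poly h \<alpha> - of_nat b else 0) + (if Suc a = b then coeff h 1 else 0)"
  by (cases b) (auto simp: Gop_def coeff_Fop_monom coeff_pCons)

lemma sum_fun_apply: "(\<Sum>i\<in>I. f i) q = (\<Sum>i\<in>I. f i q)" for f :: "'i \<Rightarrow> 'a \<Rightarrow> 'b::comm_monoid_add"
  by (induction I rule: infinite_finite_induct) auto

definition tens_pure :: "nat \<times> nat \<Rightarrow> 'v \<Rightarrow> nat \<times> nat \<Rightarrow> 'v::ab_group_add" where
  "tens_pure p v = (\<lambda>q. if q = p then v else 0)"

definition mult_t :: "(nat \<times> nat \<Rightarrow> 'v) \<Rightarrow> nat \<times> nat \<Rightarrow> 'v::ab_group_add" where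
  "mult_t F = (\<lambda>q. if fst q = 0 then 0 else F (fst q - 1, snd q))"

definition mult_s :: "(nat \<times> nat \<Rightarrow> 'v) \<Rightarrow> nat \<times> nat \<Rightarrow> 'v::ab_group_add" where
  "mult_s F = (\<lambda>q. if snd q = 0 then 0 else F (fst q, snd q - 1))"

lemma mult_t_pure: "mult_t (tens_pure (a, i) v) = tens_pure (Suc a, i) v"
  by (auto simp: mult_t_def tens_pure_def fun_eq_iff)

lemma mult_s_pure: "mult_s (tens_pure (a, i) v) = tens_pure (a, Suc i) v"
  by (auto simp: mult_s_def tens_pure_def fun_eq_iff)

lemma tens_pure_expansion:
  assumes "F \<in> tens_carrier"
  shows "F = (\<Sum>p\<in>{p. F p \<noteq> 0}. tens_pure p (F p))"
proof
  fix q
  have "(\<Sum>p\<in>{p. F p \<noteq> 0}. tens_pure p (F p) q) = (\<Sum>p\<in>{p. F p \<noteq> 0}. if p = q then F q else 0)"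
    by (rule sum.cong) (auto simp: tens_pure_def)
  then show "F q = (\<Sum>p\<in>{p. F p \<noteq> 0}. tens_pure p (F p)) q"
    using assms by (simp add: sum_fun_apply tens_carrier_def)
qed

context vir_module
begin

lemma vector_space_tens: "vector_space (tens_sc sc)"
  by unfold_locales (auto simp: tens_sc_def scale_right_distrib scale_left_distrib fun_eq_iff)

definition deriv_t :: "(nat \<times> nat \<Rightarrow> 'v) \<Rightarrow> nat \<times> nat \<Rightarrow> 'v" where
  "deriv_t F = (\<lambda>q. sc (of_nat (Suc (fst q))) (F (Suc (fst q), snd q)))"

text \<open>The coefficient of m^l in lam^(-m) d_m F, as far as d_m acts on the polynomial
  factor.\<close>

definition tens_mode :: "complex \<Rightarrow> complex poly \<Rightarrow> nat \<Rightarrow> (nat \<times> nat \<Rightarrow> 'v) \<Rightarrow> nat \<times> nat \<Rightarrow> 'v" where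
  "tens_mode \<alpha> h l F =
     (\<lambda>q. \<Sum>p\<in>{p. F p \<noteq> 0}. sc (bicoeff (omega_mode \<alpha> h l (snd p) (monom 1 (fst p))) q) (F p))"

lemma tens_d_modes:
  assumes "\<And>p. F p \<noteq> 0 \<Longrightarrow> snd p \<le> N" "\<And>p. d m (F p) = 0"
  shows "tens_d lam \<alpha> h sc d m F =
    tens_sc sc (lam powi m) (\<Sum>l\<le>Suc (Suc N). tens_sc sc (of_int m ^ l) (tens_mode \<alpha> h l F))"
proof
  fix q
  let ?S = "{p. F p \<noteq> 0}"
  let ?b = "\<lambda>l p. bicoeff (omega_mode \<alpha> h l (snd p) (monom 1 (fst p))) q"
  have "tens_d lam \<alpha> h sc d m F q = (\<Sum>p\<in>?S. sc (omega_coeff lam \<alpha> h m p q) (F p))"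
    using assms(2) by (simp add: tens_d_def)
  also have "\<dots> = (\<Sum>p\<in>?S. sc (lam powi m) (\<Sum>l\<le>Suc (Suc N). sc (of_int m ^ l) (sc (?b l p) (F p))))"
  proof (rule sum.cong[OF refl])
    fix p assume "p \<in> ?S"
    then have "snd p \<le> N" using assms(1) by blast
    then have "omega_coeff lam \<alpha> h m p q = lam powi m * (\<Sum>l\<le>Suc (Suc N). of_int m ^ l * ?b l p)"
      unfolding omega_coeff_bicoeff omega_d_monom
      by (simp only: omega_term_modes bicoeff_smult bicoeff_sum)
    then show "sc (omega_coeff lam \<alpha> h m p q) (F p) =
        sc (lam powi m) (\<Sum>l\<le>Suc (Suc N). sc (of_int m ^ l) (sc (?b l p) (F p)))"
      by (simp only: scale_scale[symmetric] scale_sum_left)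
  qed
  also have "\<dots> = sc (lam powi m) (\<Sum>l\<le>Suc (Suc N). sc (of_int m ^ l) (tens_mode \<alpha> h l F q))"
    unfolding tens_mode_def scale_sum_right sum.swap[of _ "{..Suc (Suc N)}"] ..
  finally show "tens_d lam \<alpha> h sc d m F q = tens_sc sc (lam powi m)
      (\<Sum>l\<le>Suc (Suc N). tens_sc sc (of_int m ^ l) (tens_mode \<alpha> h l F)) q"
    unfolding tens_sc_def sum_fun_apply .
qed

lemma sum_over_support:
  assumes "finite {p. F p \<noteq> 0}" "finite T" "\<And>p. F p \<noteq> 0 \<Longrightarrow> p \<notin> T \<Longrightarrow> r p = 0"
  shows "(\<Sum>p\<in>{p. F p \<noteq> 0}. sc (r p) (F p)) = (\<Sum>p\<in>T. sc (r p) (F p))"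
  by (rule sum.mono_neutral_cong) (use assms in auto)

lemma tens_mode_0:
  assumes "F \<in> tens_carrier"
  shows "tens_mode \<alpha> h 0 F = mult_s F"
proof
  fix q :: "nat \<times> nat"
  obtain b j where q: "q = (b, j)" by fastforce
  have fin: "finite {p. F p \<noteq> 0}" using assms by (simp add: tens_carrier_def)
  have bi: "bicoeff (omega_mode \<alpha> h 0 (snd p) (monom 1 (fst p))) q = (if Suc (snd p) = j \<and> fst p = b then 1 else 0)" for p
    by (auto simp: omega_mode_0 bicoeff_def q)
  have "tens_mode \<alpha> h 0 F q = (\<Sum>p\<in>(if j = 0 then {} else {(b, j - 1)}).
      sc (if Suc (snd p) = j \<and> fst p = b then 1 else 0) (F p))"
    unfolding tens_mode_def bi using fin by (intro sum_over_support) (auto split: if_splits)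
  also have "\<dots> = mult_s F q" by (auto simp: mult_s_def q)
  finally show "tens_mode \<alpha> h 0 F q = mult_s F q" .
qed

text \<open>\<open>R\<close> is the coefficient of s^N moved to s-degree 0. For linear h the
  operator F is b - d/dt with b the leading coefficient, so the difference on the right is F applied
  to \<open>R\<close>.\<close>

lemma tens_mode_top:
  assumes "F \<in> tens_carrier" "degree h = 1" "\<And>p. F p \<noteq> 0 \<Longrightarrow> snd p \<le> N"
  defines "R \<equiv> (\<lambda>q. if snd q = 0 then F (fst q, N) else 0)"
  shows "tens_mode \<alpha> h (Suc (Suc N)) F =
    tens_sc sc (- ((- 1) ^ N * \<alpha>)) (tens_sc sc (coeff h 1) R - deriv_t R)"
proof
  fix q :: "nat \<times> nat"
  obtain b j where q: "q = (b, j)" by fastforce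
  let ?k = "- ((- 1) ^ N * \<alpha>)"
  let ?c = "\<lambda>p. if snd p = N \<and> j = 0 then ?k * ((if fst p = b then coeff h 1 else 0) -
      (if fst p = Suc b then of_nat (fst p) else 0)) else 0"
  have fin: "finite {p. F p \<noteq> 0}" using assms by (simp add: tens_carrier_def)
  have bi: "bicoeff (omega_mode \<alpha> h (Suc (Suc N)) (snd p) (monom 1 (fst p))) q = ?c p"
    if "F p \<noteq> 0" for p
    unfolding omega_mode_top[OF assms(3)[OF that]]
    by (cases j) (auto simp: bicoeff_def q coeff_Fop_monom[OF assms(2)])
  have "tens_mode \<alpha> h (Suc (Suc N)) F q = (\<Sum>p\<in>{p. F p \<noteq> 0}. sc (?c p) (F p))"
    unfolding tens_mode_def by (intro sum.cong) (simp_all add: bi del: scale_cancel_right)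
  also have "\<dots> = (\<Sum>p\<in>{(b, N), (Suc b, N)}. sc (?c p) (F p))"
    using fin by (intro sum_over_support) (auto simp: prod_eq_iff)
  also have "\<dots> = tens_sc sc ?k (tens_sc sc (coeff h 1) R - deriv_t R) q"
    by (auto simp: q tens_sc_def R_def deriv_t_def scale_right_diff_distrib algebra_simps)
  finally show "tens_mode \<alpha> h (Suc (Suc N)) F q =
    tens_sc sc ?k (tens_sc sc (coeff h 1) R - deriv_t R) q" .
qed

text \<open>On elements free of s the coefficient of m is G, which for linear h is h(\<alpha>) + t
  (b - d/dt) with b the leading coefficient.\<close>

lemma tens_mode_1:
  assumes "F \<in> tens_carrier" "degree h = 1" "\<And>p. F p \<noteq> 0 \<Longrightarrow> snd p = 0"
  shows "tens_mode \<alpha> h 1 F =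
    tens_sc sc (poly h \<alpha>) F + tens_sc sc (coeff h 1) (mult_t F) - mult_t (deriv_t F)"
proof
  fix q :: "nat \<times> nat"
  obtain b j where q: "q = (b, j)" by fastforce
  let ?c = "\<lambda>p. if j = 0 then (if fst p = b then poly h \<alpha> - of_nat b else 0) +
      (if Suc (fst p) = b then coeff h 1 else 0) else 0"
  have fin: "finite {p. F p \<noteq> 0}" using assms by (simp add: tens_carrier_def)
  have F0: "F (a, Suc i) = 0" for a i using assms(3)[of "(a, Suc i)"] by auto
  have bi: "bicoeff (omega_mode \<alpha> h 1 (snd p) (monom 1 (fst p))) q = ?c p"
    if "F p \<noteq> 0" for p
    unfolding assms(3)[OF that] omega_mode_1_0
    by (cases j) (auto simp: bicoeff_def q coeff_Gop_monom[OF assms(2)])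
  have "tens_mode \<alpha> h 1 F q = (\<Sum>p\<in>{p. F p \<noteq> 0}. sc (?c p) (F p))"
    unfolding tens_mode_def by (intro sum.cong) (simp_all add: bi del: scale_cancel_right One_nat_def)
  \<comment> \<open>For \<open>b = 0\<close> the two points coincide, and the condition
    \<open>Suc (fst p) = b\<close> never holds.\<close>
  also have "\<dots> = (\<Sum>p\<in>{(b, 0), (b - 1, 0)}. sc (?c p) (F p))"
  proof (rule sum_over_support[OF fin])
    fix p assume "F p \<noteq> 0" "p \<notin> {(b, 0), (b - 1, 0)}"
    then show "?c p = 0" using assms(3)[of p] by (cases p) auto
  qed simp
  also have "\<dots> = (tens_sc sc (poly h \<alpha>) F + tens_sc sc (coeff h 1) (mult_t F) - mult_t (deriv_t F)) q"
    using F0 by (cases b; cases j)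
      (auto simp: q tens_sc_def mult_t_def deriv_t_def scale_left_diff_distrib algebra_simps)
  finally show "tens_mode \<alpha> h 1 F q =
    (tens_sc sc (poly h \<alpha>) F + tens_sc sc (coeff h 1) (mult_t F) - mult_t (deriv_t F)) q" .
qed

end

section \<open>Submodules of the tensor product for linear h and nonzero \<alpha>\<close>

locale tensor_submodule = vir_module sc d c
  for sc :: "complex \<Rightarrow> 'v::ab_group_add \<Rightarrow> 'v" and d :: "int \<Rightarrow> 'v \<Rightarrow> 'v" and c :: "'v \<Rightarrow> 'v" +
  fixes lam \<alpha> :: complex and h :: "complex poly" and W :: "(nat \<times> nat \<Rightarrow> 'v) set"
  assumes submodule: "vir_submodule tens_carrier (tens_sc sc) (tens_d lam \<alpha> h sc d) (tens_c c) W"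
    and modes_vanish: "\<And>x. \<exists>M. \<forall>i\<ge>M. d (int i) x = 0"
    and lam: "lam \<noteq> 0" and \<alpha>: "\<alpha> \<noteq> 0" and h: "degree h = 1"
begin

sublocale tens: vector_space "tens_sc sc"
  by (rule vector_space_tens)

lemma W_carrier: "F \<in> W \<Longrightarrow> F \<in> tens_carrier"
  and W_d: "F \<in> W \<Longrightarrow> tens_d lam \<alpha> h sc d m F \<in> W"
  and W_c: "F \<in> W \<Longrightarrow> tens_c c F \<in> W"
  and subspace_W: "tens.subspace W"
  using submodule unfolding vir_submodule_def tens.subspace_def by auto

lemmas W_0 = tens.subspace_0[OF subspace_W]
  and W_add = tens.subspace_add[OF subspace_W]
  and W_diff = tens.subspace_diff[OF subspace_W]
  and W_scale = tens.subspace_scale[OF subspace_W]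
  and W_sum = tens.subspace_sum[OF subspace_W]

lemma W_cancel: "tens_sc sc r F \<in> W \<Longrightarrow> r \<noteq> 0 \<Longrightarrow> F \<in> W"
  using W_scale[of "tens_sc sc r F" "inverse r"] by simp

lemma coeff_h: "coeff h 1 \<noteq> 0"
  using h by (metis leading_coeff_0_iff degree_0 zero_neq_one)

lemma finite_support: "F \<in> W \<Longrightarrow> finite {p. F p \<noteq> 0}"
  using W_carrier by (simp add: tens_carrier_def)

text \<open>Past a common threshold d_k kills the finitely many values of \<open>F\<close>, so d_k F
  is lam^k times a polynomial in k with the modes as coefficients.
  \<open>subspace_polynomial_coeff\<close> extracts them.\<close>

lemma W_mode:
  assumes F: "F \<in> W" and N: "\<And>p. F p \<noteq> 0 \<Longrightarrow> snd p \<le> N" and l: "l \<le> Suc (Suc N)"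
  shows "tens_mode \<alpha> h l F \<in> W"
proof -
  obtain M where M: "\<And>x i. i \<ge> M x \<Longrightarrow> d (int i) x = 0" using modes_vanish by metis
  \<comment> \<open>The sum dominates each individual threshold.\<close>
  define K where "K = (\<Sum>p\<in>{p. F p \<noteq> 0}. M (F p))"
  have dF: "d (int k) (F p) = 0" if "k \<ge> K" for k p
  proof (cases "F p = 0")
    case False
    then have "M (F p) \<le> K"
      unfolding K_def using finite_support[OF F] by (intro member_le_sum) auto
    then show ?thesis using M that le_trans by blast
  qed (simp add: d_zero)
  have "(\<Sum>l\<le>Suc (Suc N). tens_sc sc (of_nat k ^ l) (tens_mode \<alpha> h l F)) \<in> W" if "k \<ge> K" for k
  proof (rule W_cancel)
    have "tens_d lam \<alpha> h sc d (int k) F = tens_sc sc (lam powi int k)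
        (\<Sum>l\<le>Suc (Suc N). tens_sc sc (of_int (int k) ^ l) (tens_mode \<alpha> h l F))"
      using N dF[OF that] by (rule tens_d_modes)
    then show "tens_sc sc (lam powi int k) (\<Sum>l\<le>Suc (Suc N). tens_sc sc (of_nat k ^ l) (tens_mode \<alpha> h l F)) \<in> W"
      using W_d[OF F, of "int k"] by (simp only: of_int_of_nat_eq)
    show "lam powi int k \<noteq> 0" using lam by simp
  qed
  then show ?thesis
    by (rule subspace_polynomial_coeff[OF vector_space_tens subspace_W _ l])
qed

lemma W_mult_s: "F \<in> W \<Longrightarrow> mult_s F \<in> W"
proof -
  assume F: "F \<in> W"
  have "snd p \<le> Max (snd ` {p. F p \<noteq> 0})" if "F p \<noteq> 0" for p
    using finite_support[OF F] that by (intro Max_ge) auto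
  from W_mode[OF F this, of 0] show ?thesis
    by (simp add: tens_mode_0[OF W_carrier[OF F]])
qed

lemma W_top:
  assumes "F \<in> W" "\<And>p. F p \<noteq> 0 \<Longrightarrow> snd p \<le> N"
  defines "R \<equiv> (\<lambda>q. if snd q = 0 then F (fst q, N) else 0)"
  shows "tens_sc sc (coeff h 1) R - deriv_t R \<in> W"
proof (rule W_cancel)
  show "tens_sc sc (- ((- 1) ^ N * \<alpha>)) (tens_sc sc (coeff h 1) R - deriv_t R) \<in> W"
    using W_mode[OF assms(1,2) order_refl] tens_mode_top[OF W_carrier[OF assms(1)] h assms(2), where \<alpha>=\<alpha>]
    unfolding R_def by simp
  show "- ((- 1) ^ N * \<alpha>) \<noteq> 0" using \<alpha> by simp
qed

text \<open>Without s, \<open>F\<close> is its own leading s-coefficient, so \<open>W_top\<close>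
  yields b F - F' with b the leading coefficient of h; subtract this from b F.\<close>

lemma W_deriv_t:
  assumes "F \<in> W" "\<And>p. F p \<noteq> 0 \<Longrightarrow> snd p = 0"
  shows "deriv_t F \<in> W"
proof -
  have "(\<lambda>q. if snd q = 0 then F (fst q, 0) else 0) = F"
  proof
    fix q show "(if snd q = 0 then F (fst q, 0) else 0) = F q"
      using assms(2)[of q] by (cases q) auto
  qed
  then have "tens_sc sc (coeff h 1) F - deriv_t F \<in> W"
    using W_top[OF assms(1), of 0] assms(2) by simp
  from W_diff[OF W_scale[OF assms(1), of "coeff h 1"] this] show ?thesis by simp
qed

text \<open>The first mode is h(\<alpha>) F + b t F - t F' with b nonzero. Induction on the t-degree
  puts t F' into \<open>W\<close>, which leaves t F.\<close>

lemma W_mult_t: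
  assumes "F \<in> W" "\<And>p. F p \<noteq> 0 \<Longrightarrow> snd p = 0 \<and> fst p \<le> n"
  shows "mult_t F \<in> W"
  using assms
proof (induction n arbitrary: F)
  case (0 F)
  have "deriv_t F = 0" using "0.prems"(2) by (force simp: deriv_t_def fun_eq_iff)
  then have z: "mult_t (deriv_t F) = 0" by (simp add: mult_t_def fun_eq_iff)
  have "tens_mode \<alpha> h 1 F \<in> W" using 0 by (intro W_mode[of _ 0]) auto
  then have "tens_sc sc (poly h \<alpha>) F + tens_sc sc (coeff h 1) (mult_t F) \<in> W"
    using tens_mode_1[OF W_carrier[OF "0.prems"(1)] h] "0.prems"(2) z by simp
  from W_diff[OF this W_scale[OF "0.prems"(1)]] have "tens_sc sc (coeff h 1) (mult_t F) \<in> W"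
    by (metis add_diff_cancel_left')
  then show ?case using W_cancel coeff_h by blast
next
  case (Suc n F)
  have s0: "\<And>p. F p \<noteq> 0 \<Longrightarrow> snd p = 0" using Suc.prems(2) by blast
  have "snd p = 0 \<and> fst p \<le> n" if "deriv_t F p \<noteq> 0" for p
  proof -
    have "F (Suc (fst p), snd p) \<noteq> 0" using that by (auto simp: deriv_t_def)
    then show ?thesis using Suc.prems(2) by fastforce
  qed
  then have t: "mult_t (deriv_t F) \<in> W"
    using Suc.IH W_deriv_t[OF Suc.prems(1) s0] by blast
  have "tens_mode \<alpha> h 1 F \<in> W" using Suc.prems by (intro W_mode[of _ 0]) auto
  then have "tens_sc sc (poly h \<alpha>) F + tens_sc sc (coeff h 1) (mult_t F) - mult_t (deriv_t F) \<in> W"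
    using tens_mode_1[OF W_carrier[OF Suc.prems(1)] h s0] by simp
  from W_diff[OF W_add[OF this t] W_scale[OF Suc.prems(1)]]
  have "tens_sc sc (coeff h 1) (mult_t F) \<in> W"
    by (metis add_diff_cancel_left' diff_add_cancel)
  then show ?case using W_cancel coeff_h by blast
qed

lemma W_pure_all:
  assumes "tens_pure (0, 0) v \<in> W"
  shows "tens_pure p v \<in> W"
proof -
  have t: "tens_pure (a, 0) v \<in> W" for a
  proof (induction a)
    case (Suc a)
    show ?case unfolding mult_t_pure[symmetric]
      by (rule W_mult_t[OF Suc, of a]) (auto simp: tens_pure_def split: if_splits)
  qed (rule assms)
  have "tens_pure (a, i) v \<in> W" for a i
    by (induction i) (auto simp: t simp flip: mult_s_pure intro: W_mult_s)
  then show ?thesis by (cases p) simp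
qed

text \<open>Differentiate in t until only the constant term remains.\<close>

lemma W_contains_pure_aux:
  assumes "F \<in> W" "F \<noteq> 0" "\<And>p. F p \<noteq> 0 \<Longrightarrow> snd p = 0 \<and> fst p \<le> n"
  shows "\<exists>v. v \<noteq> 0 \<and> tens_pure (0, 0) v \<in> W"
  using assms
proof (induction n arbitrary: F)
  case (0 F)
  have "F = tens_pure (0, 0) (F (0, 0))"
    using "0.prems"(3) by (force simp: tens_pure_def fun_eq_iff)
  then have W: "tens_pure (0, 0) (F (0, 0)) \<in> W" "tens_pure (0, 0) (F (0, 0)) \<noteq> 0"
    using "0.prems"(1,2) by metis+
  have "F (0, 0) \<noteq> 0"
  proof
    assume "F (0, 0) = 0"
    with W(2) show False by (auto simp: tens_pure_def fun_eq_iff)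
  qed
  with W(1) show ?case by blast
next
  case (Suc n F)
  show ?case
  proof (cases "F (Suc n, 0) = 0")
    case True
    have "snd p = 0 \<and> fst p \<le> n" if "F p \<noteq> 0" for p
      using Suc.prems(3)[OF that] that True by (cases p) (auto simp: le_Suc_eq)
    then show ?thesis by (rule Suc.IH[OF Suc.prems(1,2)])
  next
    case False
    have "deriv_t F (n, 0) \<noteq> 0" using False by (simp add: deriv_t_def del: of_nat_Suc)
    then have nz: "deriv_t F \<noteq> 0" by (metis zero_fun_apply)
    have "snd p = 0 \<and> fst p \<le> n" if "deriv_t F p \<noteq> 0" for p
    proof -
      have "F (Suc (fst p), snd p) \<noteq> 0" using that by (auto simp: deriv_t_def)
      then show ?thesis using Suc.prems(3) by fastforce
    qed
    moreover have "deriv_t F \<in> W" using W_deriv_t[OF Suc.prems(1)] Suc.prems(3) by blast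
    ultimately show ?thesis using Suc.IH[OF _ nz] by blast
  qed
qed

text \<open>The top mode removes s: it puts E = b R - R' into \<open>W\<close>, where R is the
  leading s-coefficient. As b is nonzero, E has the t-degree of R and cannot vanish.\<close>

lemma W_contains_pure:
  assumes "W \<noteq> {0}"
  shows "\<exists>v. v \<noteq> 0 \<and> tens_pure (0, 0) v \<in> W"
proof -
  obtain F where F: "F \<in> W" "F \<noteq> 0" using assms W_0 by blast
  let ?S = "{p. F p \<noteq> 0}"
  have fin: "finite ?S" using F finite_support by blast
  have ne: "?S \<noteq> {}" using F(2) by (auto simp: fun_eq_iff)
  define N where "N = Max (snd ` ?S)"
  have N: "snd p \<le> N" if "F p \<noteq> 0" for p
    unfolding N_def using fin that by (intro Max_ge) auto
  have "N \<in> snd ` ?S" unfolding N_def using fin ne by (intro Max_in) auto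
  then have A: "{a. F (a, N) \<noteq> 0} \<noteq> {}" by auto
  have finA: "finite {a. F (a, N) \<noteq> 0}"
    by (rule finite_subset[OF _ finite_imageI[OF fin, of fst]]) force
  define b where "b = Max {a. F (a, N) \<noteq> 0}"
  have b: "F (b, N) \<noteq> 0" "\<And>a. F (a, N) \<noteq> 0 \<Longrightarrow> a \<le> b"
    using Max_in[OF finA A] Max_ge[OF finA] unfolding b_def by auto
  define E where "E = tens_sc sc (coeff h 1) (\<lambda>q. if snd q = 0 then F (fst q, N) else 0)
      - deriv_t (\<lambda>q. if snd q = 0 then F (fst q, N) else 0)"
  have E: "E (a, j) = (if j = 0 then sc (coeff h 1) (F (a, N)) - sc (of_nat (Suc a)) (F (Suc a, N)) else 0)" for a j
    by (simp add: E_def tens_sc_def deriv_t_def)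
  have "E \<in> W" unfolding E_def by (rule W_top[OF F(1) N])
  moreover have "F (Suc b, N) = 0" using b(2)[of "Suc b"] by fastforce
  then have "E (b, 0) \<noteq> 0" using b(1) coeff_h by (simp add: E)
  then have "E \<noteq> 0" by (metis zero_fun_apply)
  moreover have "snd p = 0 \<and> fst p \<le> b" if "E p \<noteq> 0" for p
  proof -
    obtain a j where p: "p = (a, j)" by (cases p)
    have "j = 0 \<and> (F (a, N) \<noteq> 0 \<or> F (Suc a, N) \<noteq> 0)"
      using that unfolding p E by (auto split: if_splits)
    then show ?thesis using b(2)[of a] b(2)[of "Suc a"] p by auto
  qed
  ultimately show ?thesis using W_contains_pure_aux by blast
qed

lemma W_of_pure_values:
  assumes "F \<in> tens_carrier" "\<And>q. tens_pure q (F q) \<in> W"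
  shows "F \<in> W"
  by (subst tens_pure_expansion[OF assms(1)]) (intro W_sum assms(2))

text \<open>The vectors v whose tensors with all of Omega lie in \<open>W\<close> form a nonzero
  submodule of V, which irreducibility makes everything.\<close>

lemma W_total:
  assumes "vir_irreducible UNIV sc d c" "W \<noteq> {0}"
  shows "W = tens_carrier"
proof -
  define U where "U = {v. \<forall>p. tens_pure p v \<in> W}"
  have "vir_submodule UNIV sc d c U"
    unfolding vir_submodule_def
  proof (intro conjI ballI allI)
    have "tens_pure p 0 = (0 :: nat \<times> nat \<Rightarrow> 'v)" for p by (simp add: tens_pure_def fun_eq_iff)
    then show "0 \<in> U" using W_0 by (simp add: U_def)
    fix x assume x: "x \<in> U"
    show "x + y \<in> U" if "y \<in> U" for y
    proof -
      have "tens_pure p (x + y) = tens_pure p x + tens_pure p y" for p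
        by (simp add: tens_pure_def fun_eq_iff)
      then show ?thesis using x that by (simp add: U_def W_add)
    qed
    have scale: "sc r x \<in> U" for r
    proof -
      have "tens_pure p (sc r x) = tens_sc sc r (tens_pure p x)" for p
        by (simp add: tens_pure_def tens_sc_def fun_eq_iff)
      then show ?thesis using x by (simp add: U_def W_scale)
    qed
    then show "sc r x \<in> U" for r .
    show "c x \<in> U"
    proof -
      have "tens_pure p (c x) = tens_c c (tens_pure p x)" for p
        by (simp add: tens_pure_def tens_c_def c_zero fun_eq_iff)
      then show ?thesis using x by (simp add: U_def W_c)
    qed
    show "d m x \<in> U" for m
      unfolding U_def
    proof (intro CollectI allI)
      fix p
      \<comment> \<open>\<open>G\<close> is the part of d_m (p tensor x) in which d_m acts on Omega.
        Its values are multiples of \<open>x\<close>, so it lies in \<open>W\<close>, and the part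
        with d_m acting on \<open>x\<close> remains.\<close>
      define G where "G = (\<lambda>q. sc (omega_coeff lam \<alpha> h m p q) x)"
      have "tens_d lam \<alpha> h sc d m (tens_pure p x) = G + tens_pure p (d m x)"
      proof
        fix q
        have "(\<Sum>r\<in>{r. tens_pure p x r \<noteq> 0}. sc (omega_coeff lam \<alpha> h m r q) (tens_pure p x r))
            = (\<Sum>r\<in>{p}. sc (omega_coeff lam \<alpha> h m r q) (tens_pure p x r))"
          by (rule sum_over_support) (auto simp: tens_pure_def split: if_splits)
        then show "tens_d lam \<alpha> h sc d m (tens_pure p x) q = (G + tens_pure p (d m x)) q"
          by (simp add: tens_d_def G_def tens_pure_def d_zero)
      qed
      then have "tens_pure p (d m x) = tens_d lam \<alpha> h sc d m (tens_pure p x) - G" by simp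
      moreover have "G \<in> W"
      proof (rule W_of_pure_values)
        have "finite {q. omega_coeff lam \<alpha> h m p q \<noteq> 0}"
          by (simp add: omega_coeff_bicoeff finite_bicoeff)
        then show "G \<in> tens_carrier"
          unfolding tens_carrier_def G_def by (auto elim!: rev_finite_subset)
        show "tens_pure q (G q) \<in> W" for q
          using scale unfolding G_def U_def by blast
      qed
      moreover have "tens_pure p x \<in> W" using x unfolding U_def by blast
      ultimately show "tens_pure p (d m x) \<in> W" by (simp only: W_diff W_d)
    qed
  qed simp
  then have "U = {0} \<or> U = UNIV" using assms(1) unfolding vir_irreducible_def by blast
  moreover obtain v where "v \<noteq> 0" "v \<in> U"
    using W_contains_pure[OF assms(2)] W_pure_all unfolding U_def by blast
  ultimately have "U = UNIV" by blast
  then have "F \<in> W" if "F \<in> tens_carrier" for F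
    using W_of_pure_values[OF that] unfolding U_def by blast
  then show ?thesis using W_carrier by blast
qed

end

theorem theorem3p2:
  fixes lam \<alpha> :: complex and h :: "complex poly"
    and sc :: "complex \<Rightarrow> 'v::ab_group_add \<Rightarrow> 'v" and d :: "int \<Rightarrow> 'v \<Rightarrow> 'v" and c :: "'v \<Rightarrow> 'v"
  assumes "lam \<noteq> 0"
    and "is_vir_module UNIV sc d c"
    and "vir_irreducible UNIV sc d c"
    and "\<exists>N::nat. \<forall>k::nat. N \<le> k \<longrightarrow> locally_finite_op UNIV sc (d (int k))"
  shows "(vir_irreducible tens_carrier (tens_sc sc) (tens_d lam \<alpha> h sc d) (tens_c c)
            \<longleftrightarrow> vir_irreducible UNIV omega_sc (omega_d lam \<alpha> h) omega_c)
       \<and> (vir_irreducible UNIV omega_sc (omega_d lam \<alpha> h) omega_c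
            \<longleftrightarrow> degree h = 1 \<and> \<alpha> \<noteq> 0)"
proof -
  interpret vir_module sc d c by unfold_locales fact
  obtain v :: 'v where v: "v \<noteq> 0"
    using assms(3) unfolding vir_irreducible_def by blast
  obtain N :: nat where "\<And>k. N \<le> k \<Longrightarrow> locally_finite_op UNIV sc (d (int k))"
    using assms(4) by blast
  \<comment> \<open>\<open>Suc N\<close> guarantees the positive index that
    \<open>high_modes_vanish\<close> asks for.\<close>
  then have "locally_finite_op UNIV sc (d (int (Suc N)))" by (meson le_SucI order_refl)
  then have vanish: "\<exists>M. \<forall>i\<ge>M. d (int i) x = 0" for x
    by (rule high_modes_vanish[OF zero_less_Suc])
  \<comment> \<open>This closes a cycle: irreducibility of the tensor product gives that of Omega,
    which gives the condition on h and \<alpha>, which gives the former.\<close>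
  have "vir_irreducible tens_carrier (tens_sc sc) (tens_d lam \<alpha> h sc d) (tens_c c)"
    if h: "degree h = 1" and \<alpha>: "\<alpha> \<noteq> 0"
    unfolding vir_irreducible_def
  proof (intro conjI allI impI)
    have "tens_pure (0, 0) v \<in> tens_carrier"
      by (simp add: tens_carrier_def tens_pure_def)
    moreover have "tens_pure (0, 0) v (0, 0) \<noteq> 0" using v by (simp add: tens_pure_def)
    ultimately show "tens_carrier \<noteq> {0 :: nat \<times> nat \<Rightarrow> 'v}"
      by (metis singletonD zero_fun_apply)
    fix W assume W: "vir_submodule tens_carrier (tens_sc sc) (tens_d lam \<alpha> h sc d) (tens_c c) W"
    interpret tensor_submodule sc d c lam \<alpha> h W
      by unfold_locales (rule W vanish assms(1) h \<alpha>)+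
    show "W = {0} \<or> W = tens_carrier" using W_total[OF assms(3)] by blast
  qed
  then show ?thesis
    using tensor_irreducible_imp_omega_irreducible[OF v] omega_irreducible_imp by blast
qed

end
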